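(* Let $k$ be an infinite field, $R=k[x_1,\ldots,x_n]$, let $I$ be a Borel-fixed ideal of $R$, and let $s\ge d=\dim R/I$. Then: (i) For every $s$-reduction $\mathfrak q$ of $R/I$, there exist variables $x_{i_1},\ldots,x_{i_{s-d}}$ with $1\le i_1<\cdots<i_{s-d}\le n-d$ such that $$r_{\mathfrak q}(R/I)=r_{(x_{i_1},\ldots,x_{i_{s-d}},x_{n-d+1},\ldots,x_n)}(R/I).$$ (ii) $r_s(R/I)=r_{(x_{n-s+1},\ldots,x_n)}(R/I)$.
   Context: A monomial ideal $I$ of $R=k[x_1,\ldots,x_n]$ is called Borel-fixed if $g(I)=I$ for all $g$ in the Borel subgroup $\mathcal B\subset \mathrm{GL}(n,k)$ of upper triangular invertible matrices; here $g=(g_{ij})$ acts as the $k$-algebra automorphism of $R$ with $g(x_j)=\sum_{i\le j} g_{ij}x_i$. Let $A$ be a standard graded algebra over $k$. An ideal $\mathfrak q=(z_1,\ldots,z_s)$, where $z_1,\ldots,z_s$ are linear forms of $A$, is called an $s$-reduction of $A$ if $\mathfrak q_t=A_t$ for all $t$ large enough. The reduction number $r_{\mathfrak q}(A)$ is the minimum integer $r\ge 0$ such that $\mathfrak q_{r+1}=A_{r+1}$. The $s$-reduction number of $A$ is $r_s(A)=\min\{r_{\mathfrak q}(A)\mid \mathfrak q=(z_1,\ldots,z_s)\text{ is a reduction of }A\}$. If $Q\subset R$ is an ideal which generates a reduction $\mathfrak q$ of $R/I$, then $r_Q(R/I)$ denotes $r_{\mathfrak q}(R/I)$.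
   Formalization: In (i), q is assumed generated by images of s linearly independent linear forms of R (it fails for I=(x_1^2) in k[x_1,x_2], s=2, q=(x_2,x_2)); s ≤ n is assumed so that the named variables exist, and I ≠ R. *)

theory Defs
  imports
    "HOL-Library.Poly_Mapping"
    "HOL-Library.Extended_Real"
    "HOL-Algebra.Ideal"
    "HOL-Algebra.QuotRing"
    "Jordan_Normal_Form.Matrix"
begin

text \<open>
  A monomial is a finitely supported exponent vector and a polynomial is a finitely
  supported family of coefficients.  The variables are \<open>x\<^sub>1, x\<^sub>2, \<dots>\<close>, indexed from 1, and
  \<open>k[x\<^sub>1,\<dots>,x\<^sub>n]\<close> is the subring of the polynomials involving only \<open>x\<^sub>1,\<dots>,x\<^sub>n\<close>.
\<close>

type_synonym 'k mpoly = "(nat \<Rightarrow>\<^sub>0 nat) \<Rightarrow>\<^sub>0 'k"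

definition X :: "nat \<Rightarrow> 'k::comm_ring_1 mpoly" where
  "X i = Poly_Mapping.single (Poly_Mapping.single i 1) 1"

definition Const :: "'k::comm_ring_1 \<Rightarrow> 'k mpoly" where
  "Const a = Poly_Mapping.single 0 a"

definition polys :: "nat \<Rightarrow> 'k::comm_ring_1 mpoly set" where
  "polys n = {p. \<forall>m\<in>Poly_Mapping.keys p. Poly_Mapping.keys m \<subseteq> {1..n}}"

definition poly_ring :: "nat \<Rightarrow> 'k::comm_ring_1 mpoly ring" where
  "poly_ring n = \<lparr>carrier = polys n, monoid.mult = (*), one = 1, zero = 0, add = (+)\<rparr>"

definition mdeg :: "(nat \<Rightarrow>\<^sub>0 nat) \<Rightarrow> nat" where
  "mdeg m = (\<Sum>i\<in>Poly_Mapping.keys m. Poly_Mapping.lookup m i)"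

definition forms :: "nat \<Rightarrow> nat \<Rightarrow> 'k::comm_ring_1 mpoly set" where
  "forms n t = {p \<in> polys n. \<forall>m\<in>Poly_Mapping.keys p. mdeg m = t}"

lemma polys_add: "p \<in> polys n \<Longrightarrow> q \<in> polys n \<Longrightarrow> p + q \<in> polys n"
  using Poly_Mapping.keys_add[of p q] unfolding polys_def by blast

lemma polys_one: "1 \<in> polys n"
  by (simp add: polys_def)

lemma polys_mult:
  assumes "p \<in> polys n" "q \<in> polys n"
  shows "p * q \<in> polys n"
  unfolding polys_def
proof (intro CollectI ballI)
  fix m assume "m \<in> Poly_Mapping.keys (p * q)"
  then obtain a b where "m = a + b" "a \<in> Poly_Mapping.keys p" "b \<in> Poly_Mapping.keys q"
    using keys_mult[of p q] by blast
  then show "Poly_Mapping.keys m \<subseteq> {1..n}"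
    using assms Poly_Mapping.keys_add[of a b] unfolding polys_def by blast
qed

lemma cring_poly_ring: "cring (poly_ring n :: 'k::comm_ring_1 mpoly ring)"
proof (rule cringI)
  show "abelian_group (poly_ring n :: 'k mpoly ring)"
  proof (rule abelian_groupI)
    fix x :: "'k mpoly" assume "x \<in> carrier (poly_ring n)"
    then have "- x \<in> carrier (poly_ring n)"
      by (simp add: poly_ring_def polys_def Poly_Mapping.keys_def)
    then show "\<exists>y\<in>carrier (poly_ring n). y \<oplus>\<^bsub>poly_ring n\<^esub> x = \<zero>\<^bsub>poly_ring n\<^esub>"
      by (intro bexI[of _ "- x"]) (auto simp: poly_ring_def)
  next
    show "\<zero>\<^bsub>poly_ring n\<^esub> \<in> carrier (poly_ring n :: 'k mpoly ring)"
      by (simp add: poly_ring_def polys_def)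
  qed (auto simp: poly_ring_def polys_add add.assoc add.commute)
  show "Group.comm_monoid (poly_ring n :: 'k mpoly ring)"
    by (rule comm_monoidI)
      (simp_all add: poly_ring_def polys_mult polys_one mult.assoc mult.commute)
qed (auto simp: poly_ring_def distrib_right)


subsection \<open>Borel-fixed ideals\<close>

definition monomial_ideal :: "nat \<Rightarrow> 'k::field mpoly set \<Rightarrow> bool" where
  "monomial_ideal n I \<longleftrightarrow>
     (\<exists>M. (\<forall>m\<in>M. Poly_Mapping.keys m \<subseteq> {1..n}) \<and>
          I = Idl\<^bsub>poly_ring n\<^esub> ((\<lambda>m. Poly_Mapping.single m 1) ` M))"

definition borel :: "nat \<Rightarrow> 'k::field mat set" where
  "borel n = {g \<in> carrier_mat n n. invertible_mat g \<and> upper_triangular g}"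

text \<open>
  The substitution \<open>x\<^sub>j \<mapsto> \<Sum>\<^sub>i\<^sub>\<le>\<^sub>j g\<^sub>i\<^sub>j x\<^sub>i\<close>.  Matrix entries are indexed from 0, hence the shift.
\<close>

definition act_var :: "'k::field mat \<Rightarrow> nat \<Rightarrow> 'k mpoly" where
  "act_var g j = (\<Sum>i=1..j. Const (g $$ (i - 1, j - 1)) * X i)"

definition act :: "'k::field mat \<Rightarrow> 'k mpoly \<Rightarrow> 'k mpoly" where
  "act g p = (\<Sum>m\<in>Poly_Mapping.keys p. Const (Poly_Mapping.lookup p m) *
     (\<Prod>j\<in>Poly_Mapping.keys m. act_var g j ^ Poly_Mapping.lookup m j))"

definition borel_fixed :: "nat \<Rightarrow> 'k::field mpoly set \<Rightarrow> bool" where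
  "borel_fixed n I \<longleftrightarrow> monomial_ideal n I \<and> (\<forall>g\<in>borel n. act g ` I = I)"


subsection \<open>Krull dimension\<close>

text \<open>
  The supremum of the lengths of chains of prime ideals; the zero ring has dimension \<open>-\<infinity>\<close>.
\<close>

definition krull_dim :: "('a, 'b) ring_scheme \<Rightarrow> ereal" where
  "krull_dim A = Sup {ereal (real m) | m. \<exists>P :: nat \<Rightarrow> 'a set.
     (\<forall>i\<le>m. primeideal (P i) A) \<and> (\<forall>i<m. P i \<subset> P (Suc i))}"


subsection \<open>Reductions and reduction numbers\<close>

text \<open>
  A graded algebra is given by its underlying ring \<open>A\<close> together with the family \<open>gr\<close> of its
  homogeneous components.  The linear forms \<open>z\<^sub>1, \<dots>, z\<^sub>s\<close> generating an \<open>s\<close>-reduction may be dependent.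
\<close>

definition s_reduction ::
  "('a, 'b) ring_scheme \<Rightarrow> (nat \<Rightarrow> 'a set) \<Rightarrow> nat \<Rightarrow> 'a set \<Rightarrow> bool" where
  "s_reduction A gr s q \<longleftrightarrow>
     (\<exists>z :: nat \<Rightarrow> 'a. (\<forall>j\<in>{1..s}. z j \<in> gr 1) \<and> q = Idl\<^bsub>A\<^esub> (z ` {1..s})) \<and>
     (\<exists>t0. \<forall>t\<ge>t0. q \<inter> gr t = gr t)"

text \<open>Both minima below are meaningful only if a reduction is given, respectively exists.\<close>

definition reduction_number :: "(nat \<Rightarrow> 'a set) \<Rightarrow> 'a set \<Rightarrow> nat" where
  "reduction_number gr q = (LEAST r. q \<inter> gr (r + 1) = gr (r + 1))"

definition s_reduction_number ::
  "('a, 'b) ring_scheme \<Rightarrow> (nat \<Rightarrow> 'a set) \<Rightarrow> nat \<Rightarrow> nat" where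
  "s_reduction_number A gr s = (LEAST r. \<exists>q. s_reduction A gr s q \<and> r = reduction_number gr q)"


subsection \<open>The graded algebra \<open>R/I\<close>\<close>

definition quot_gr :: "nat \<Rightarrow> 'k::field mpoly set \<Rightarrow> nat \<Rightarrow> 'k mpoly set set" where
  "quot_gr n I t = (\<lambda>p. I +>\<^bsub>poly_ring n\<^esub> p) ` forms n t"

text \<open>The ideal of \<open>R/I\<close> generated by an ideal \<open>Q\<close> of \<open>R\<close>.\<close>

definition quot_ideal :: "nat \<Rightarrow> 'k::field mpoly set \<Rightarrow> 'k mpoly set \<Rightarrow> 'k mpoly set set" where
  "quot_ideal n I Q = Idl\<^bsub>poly_ring n Quot I\<^esub> ((\<lambda>p. I +>\<^bsub>poly_ring n\<^esub> p) ` Q)"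

definition var_ideal :: "nat \<Rightarrow> nat set \<Rightarrow> 'k::field mpoly set" where
  "var_ideal n J = Idl\<^bsub>poly_ring n\<^esub> (X ` J)"

definition independent_forms :: "nat \<Rightarrow> nat \<Rightarrow> (nat \<Rightarrow> 'k::field mpoly) \<Rightarrow> bool" where
  "independent_forms n s l \<longleftrightarrow>
     (\<forall>j\<in>{1..s}. l j \<in> forms n 1) \<and>
     (\<forall>c. (\<Sum>j=1..s. Const (c j) * l j) = 0 \<longrightarrow> (\<forall>j\<in>{1..s}. c j = 0))"

text \<open>
  A reduction of \<open>R/I\<close> by \<open>s\<close> generators that can be lifted to linearly independent linear forms
  of \<open>R\<close>; if the generators are linearly independent in \<open>R/I\<close>, every lifting is of this kind.
  Without such a condition repetitions would be allowed and \<open>r\<^sub>\<qq>(R/I)\<close> need not be attained by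
  \<open>s\<close> distinct variables: for \<open>I = (x\<^sub>1\<^sup>2) \<subseteq> k[x\<^sub>1,x\<^sub>2]\<close> the ideal \<open>(x\<^sub>2, x\<^sub>2)\<close> has reduction
  number 1, whereas \<open>(x\<^sub>1, x\<^sub>2)\<close> has reduction number 0.
\<close>

definition indep_s_reduction ::
  "nat \<Rightarrow> 'k::field mpoly set \<Rightarrow> nat \<Rightarrow> 'k mpoly set set \<Rightarrow> bool" where
  "indep_s_reduction n I s q \<longleftrightarrow>
     s_reduction (poly_ring n Quot I) (quot_gr n I) s q \<and>
     (\<exists>l. independent_forms n s l \<and> q = quot_ideal n I (Idl\<^bsub>poly_ring n\<^esub> (l ` {1..s})))"

end

theory Submission
  imports Defs "Jordan_Normal_Form.Determinant"
begin

text \<open>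
  Row echelon form turns spaces of linear forms into sets of variables.  Let \<open>V\<close> be spanned by linear
  forms and let \<open>J\<close> be the set of all indices \<open>j\<close> such that some member of \<open>V\<close> is \<open>x\<^sub>j\<close> plus a combination
  of \<open>x\<^sub>1, \<dots>, x\<^sub>j\<^sub>-\<^sub>1\<close>.  Members of this shape, one for each \<open>j \<in> J\<close>, form a basis of \<open>V\<close> and are the images of
  the variables \<open>x\<^sub>j\<close> under a unitriangular \<open>g\<close>.  As \<open>g\<close> preserves degrees and fixes \<open>I\<close>, the ideals \<open>(V) + I\<close> and
  \<open>(x\<^sub>J) + I\<close> contain all forms of degree \<open>t\<close> for the same \<open>t\<close> (\<open>linear_forms_to_variables\<close>).  Whether
  a reduction results, and with which reduction number, depends only on these degrees, so every
  reduction can be exchanged for one generated by variables; \<open>J\<close> has \<open>s\<close> elements if the \<open>s\<close> given forms are independent and at most \<open>s\<close>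
  in general.

  Since \<open>I\<close> is monomial, \<open>(x\<^sub>J) + I\<close> contains all forms of degree \<open>t\<close> iff \<open>I\<close> contains all monomials of degree
  \<open>t\<close> in the variables outside \<open>J\<close> (\<open>covers_variables_iff\<close>).  What remains is combinatorics of monomials, and
  it rests on one consequence of Borel-fixedness (\<open>borel_fixed_move\<close>): in a monomial of \<open>I\<close> the whole power
  of \<open>x\<^sub>j\<close> can be moved to \<open>x\<^sub>i\<close> for any \<open>i < j\<close>.  Only a coefficient 1 is involved, so the characteristic does not
  matter.

  Moving powers shows that the variables with a power in \<open>I\<close> are \<open>x\<^sub>1, \<dots>, x\<^sub>c\<close> for some \<open>c\<close>, and that
  \<open>I \<subseteq> (x\<^sub>1, \<dots>, x\<^sub>c)\<close> if \<open>c < n\<close>.  Hence \<open>R/I\<close> has dimension \<open>n - c\<close>, that is \<open>c = n - d\<close>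
  (\<open>nilpotent_vars_dim\<close>).  The upper bound on the dimension comes from counting: elements
  \<open>y\<^sub>i \<in> P\<^sub>i - P\<^sub>i\<^sub>-\<^sub>1\<close> of a chain of primes are algebraically independent modulo \<open>P\<^sub>0\<close>
  (\<open>prime_chain_algebraically_independent\<close>), whereas more than \<open>n - c\<close> polynomials in \<open>n - c\<close> variables are
  dependent (\<open>algebraic_dependence\<close>).

  The variables \<open>x\<^sub>j\<close>, \<open>j \<in> J\<close>, generate a reduction iff every variable outside \<open>J\<close> has a power in \<open>I\<close>, that is iff
  \<open>J\<close> contains \<open>n - d + 1, \<dots>, n\<close>; this is the first part.  For the second, moving powers to smaller indices
  turns the complement of \<open>J\<close> into an initial segment (\<open>contains_monomials_initial\<close>): every degree that works for
  some \<open>J\<close> with at most \<open>s\<close> elements also works for the last \<open>s\<close> variables.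
\<close>

section \<open>Substitution of polynomials for variables\<close>

abbreviation "keys \<equiv> Poly_Mapping.keys"

abbreviation "lookup \<equiv> Poly_Mapping.lookup"

abbreviation "single \<equiv> Poly_Mapping.single"

definition mono_eval :: "(nat \<Rightarrow> 'k::comm_ring_1 mpoly) \<Rightarrow> (nat \<Rightarrow>\<^sub>0 nat) \<Rightarrow> 'k mpoly" where
  "mono_eval f m = (\<Prod>j\<in>keys m. f j ^ lookup m j)"

definition subst :: "(nat \<Rightarrow> 'k::comm_ring_1 mpoly) \<Rightarrow> 'k mpoly \<Rightarrow> 'k mpoly" where
  "subst f p = (\<Sum>m\<in>keys p. Const (lookup p m) * mono_eval f m)"

lemma act_eq_subst: "act g = subst (act_var g)"
  by (simp add: fun_eq_iff act_def subst_def mono_eval_def)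

lemma Const_simps [simp]: "Const 0 = 0" "Const 1 = 1"
  by (simp_all add: Const_def)

lemma Const_add: "Const (a + b) = Const a + Const b"
  by (simp add: Const_def single_add)

lemma Const_mult: "Const (a * b) = Const a * Const b"
  by (simp add: Const_def mult_single)

lemma Const_sum: "Const (\<Sum>i\<in>A. f i) = (\<Sum>i\<in>A. Const (f i))"
  by (induction A rule: infinite_finite_induct) (simp_all add: Const_add)

lemma Const_mult_single: "Const a * single m b = single m (a * b)"
  by (simp add: Const_def mult_single)

lemma sum_single_lookup:
  fixes p :: "'a \<Rightarrow>\<^sub>0 'b::comm_monoid_add"
  shows "(\<Sum>m\<in>keys p. single m (lookup p m)) = p"
  by (rule poly_mapping_eqI)
    (simp add: lookup_sum lookup_single when_def in_keys_iff)

lemma poly_mapping_additive_induct [case_names zero add single]: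
  fixes p :: "'a \<Rightarrow>\<^sub>0 'b::comm_monoid_add"
  assumes "P 0" "\<And>p q. P p \<Longrightarrow> P q \<Longrightarrow> P (p + q)" "\<And>m c. P (single m c)"
  shows "P p"
proof -
  have "P (\<Sum>m\<in>A. single m (lookup p m))" for A
    by (induction A rule: infinite_finite_induct) (simp_all add: assms)
  then show ?thesis by (metis sum_single_lookup)
qed

lemma mono_eval_superset:
  assumes "finite S" "keys m \<subseteq> S"
  shows "mono_eval f m = (\<Prod>j\<in>S. f j ^ lookup m j)"
  unfolding mono_eval_def
  by (rule prod.mono_neutral_left) (use assms in \<open>auto simp: in_keys_iff\<close>)

lemma mono_eval_0 [simp]: "mono_eval f 0 = 1"
  by (simp add: mono_eval_def)

lemma mono_eval_single: "mono_eval f (single i e) = f i ^ e"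
  by (simp add: mono_eval_def)

lemma mono_eval_add: "mono_eval f (a + b) = mono_eval f a * mono_eval f b"
proof -
  let ?S = "keys a \<union> keys b"
  have "mono_eval f (a + b) = (\<Prod>j\<in>?S. f j ^ lookup (a + b) j)"
    by (rule mono_eval_superset) (use Poly_Mapping.keys_add[of a b] in auto)
  also have "\<dots> = (\<Prod>j\<in>?S. f j ^ lookup a j) * (\<Prod>j\<in>?S. f j ^ lookup b j)"
    by (simp add: lookup_add power_add prod.distrib)
  finally show ?thesis
    by (simp add: mono_eval_superset[of ?S a] mono_eval_superset[of ?S b])
qed

lemma subst_superset:
  assumes "finite S" "keys p \<subseteq> S"
  shows "subst f p = (\<Sum>m\<in>S. Const (lookup p m) * mono_eval f m)"
  unfolding subst_def
  by (rule sum.mono_neutral_left) (use assms in \<open>auto simp: in_keys_iff\<close>)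

lemma subst_0 [simp]: "subst f 0 = 0"
  by (simp add: subst_def)

lemma subst_single: "subst f (single m c) = Const c * mono_eval f m"
  by (simp add: subst_def)

lemma subst_add: "subst f (p + q) = subst f p + subst f q"
proof -
  let ?S = "keys p \<union> keys q"
  have "subst f (p + q) = (\<Sum>m\<in>?S. Const (lookup (p + q) m) * mono_eval f m)"
    by (rule subst_superset) (use Poly_Mapping.keys_add[of p q] in auto)
  also have "\<dots> = (\<Sum>m\<in>?S. Const (lookup p m) * mono_eval f m) + (\<Sum>m\<in>?S. Const (lookup q m) * mono_eval f m)"
    by (simp add: lookup_add Const_add distrib_right sum.distrib)
  finally show ?thesis
    by (simp add: subst_superset[of ?S p] subst_superset[of ?S q])
qed

lemma subst_sum: "subst f (\<Sum>i\<in>A. p i) = (\<Sum>i\<in>A. subst f (p i))"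
  by (induction A rule: infinite_finite_induct) (simp_all add: subst_add)

lemma subst_1 [simp]: "subst f 1 = 1"
  by (simp add: subst_def)

lemma subst_mult: "subst f (p * q) = subst f p * subst f q"
proof (induction p rule: poly_mapping_additive_induct)
  case (single m c)
  show ?case
  proof (induction q rule: poly_mapping_additive_induct)
    case (single m' c')
    show ?case
      by (simp add: mult_single subst_single mono_eval_add Const_mult mult_ac)
  qed (simp_all add: distrib_left subst_add)
qed (simp_all add: distrib_right subst_add)

lemma subst_Const [simp]: "subst f (Const c) = Const c"
  by (simp add: Const_def subst_single)

lemma subst_X [simp]: "subst f (X i) = f i"
  by (simp add: X_def subst_single mono_eval_single)

lemma subst_power: "subst f (p ^ e) = subst f p ^ e"
  by (induction e) (simp_all add: subst_mult)

lemma subst_mono_eval: "subst g (mono_eval f m) = mono_eval (\<lambda>j. subst g (f j)) m"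
proof -
  have "subst g (\<Prod>j\<in>A. f j ^ lookup m j) = (\<Prod>j\<in>A. subst g (f j) ^ lookup m j)" for A
    by (induction A rule: infinite_finite_induct) (simp_all add: subst_mult subst_power)
  then show ?thesis by (simp add: mono_eval_def)
qed

lemma subst_subst: "subst g (subst f p) = subst (\<lambda>j. subst g (f j)) p"
  by (induction p rule: poly_mapping_additive_induct)
    (simp_all add: subst_add subst_single subst_mult subst_mono_eval)

lemma X_power: "X i ^ e = single (single i e) 1"
  by (induction e) (simp_all add: X_def mult_single flip: single_add)

lemma mono_eval_X: "mono_eval X m = single m 1"
proof -
  have "(\<Prod>j\<in>A. X j ^ lookup m j :: 'a mpoly) = single (\<Sum>j\<in>A. single j (lookup m j)) 1" for A
  proof (induction A rule: infinite_finite_induct)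
    case (insert j A)
    then show ?case
      by (simp only: prod.insert[OF insert.hyps] sum.insert[OF insert.hyps] X_power mult_single mult_1)
  qed simp_all
  then show ?thesis by (simp add: mono_eval_def sum_single_lookup)
qed

lemma mono_eval_cong: "(\<And>j. j \<in> keys m \<Longrightarrow> f j = g j) \<Longrightarrow> mono_eval f m = mono_eval g m"
  by (simp add: mono_eval_def)

lemma subst_cong:
  assumes "\<And>m j. m \<in> keys p \<Longrightarrow> j \<in> keys m \<Longrightarrow> f j = g j"
  shows "subst f p = subst g p"
  unfolding subst_def by (intro sum.cong refl) (metis mono_eval_cong assms)

lemma subst_X_ident: "subst X p = p"
  by (simp add: subst_def mono_eval_X Const_mult_single sum_single_lookup)

lemma mdeg_superset:
  assumes "finite S" "keys m \<subseteq> S"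
  shows "mdeg m = (\<Sum>j\<in>S. lookup m j)"
  unfolding mdeg_def
  by (rule sum.mono_neutral_left) (use assms in \<open>auto simp: in_keys_iff\<close>)

lemma mdeg_add: "mdeg (a + b) = mdeg a + mdeg b"
proof -
  let ?S = "keys a \<union> keys b"
  have "mdeg (a + b) = (\<Sum>j\<in>?S. lookup (a + b) j)"
    by (rule mdeg_superset) (use Poly_Mapping.keys_add[of a b] in auto)
  then show ?thesis
    by (simp add: mdeg_superset[of ?S a] mdeg_superset[of ?S b] lookup_add sum.distrib)
qed

lemma mdeg_0 [simp]: "mdeg 0 = 0"
  by (simp add: mdeg_def)

lemma mdeg_single [simp]: "mdeg (single i e) = e"
  by (simp add: mdeg_def)

text \<open>
  Homogeneous polynomials, polynomials of bounded degree and polynomials in given variables are all of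
  the form \<open>keys p \<subseteq> Q t\<close> for such a family \<open>Q\<close>, so the behaviour of all three under products and
  substitution is treated once.
\<close>

definition graded_monos :: "(nat \<Rightarrow> (nat \<Rightarrow>\<^sub>0 nat) set) \<Rightarrow> bool" where
  "graded_monos Q \<longleftrightarrow> 0 \<in> Q 0 \<and> (\<forall>s t a b. a \<in> Q s \<longrightarrow> b \<in> Q t \<longrightarrow> a + b \<in> Q (s + t))"

lemma keys_mult_graded:
  assumes "graded_monos Q" "keys p \<subseteq> Q s" "keys q \<subseteq> Q t"
  shows "keys (p * q) \<subseteq> Q (s + t)"
proof
  fix m assume "m \<in> keys (p * q)"
  then obtain a b where "m = a + b" "a \<in> keys p" "b \<in> keys q"
    using keys_mult[of p q] by blast
  then show "m \<in> Q (s + t)"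
    using assms unfolding graded_monos_def by blast
qed

lemma keys_power_graded:
  assumes "graded_monos Q" "keys (p :: 'k::comm_ring_1 mpoly) \<subseteq> Q w"
  shows "keys (p ^ e) \<subseteq> Q (w * e)"
proof (induction e)
  case 0
  then show ?case using assms(1) by (simp add: graded_monos_def)
next
  case (Suc e)
  then show ?case using keys_mult_graded[OF assms Suc] by simp
qed

lemma keys_mono_eval_graded:
  fixes f :: "nat \<Rightarrow> 'k::comm_ring_1 mpoly"
  assumes "graded_monos Q" "\<And>j. j \<in> keys m \<Longrightarrow> keys (f j) \<subseteq> Q w"
  shows "keys (mono_eval f m) \<subseteq> Q (w * mdeg m)"
proof -
  have "A \<subseteq> keys m \<Longrightarrow> keys (\<Prod>j\<in>A. f j ^ lookup m j) \<subseteq> Q (w * (\<Sum>j\<in>A. lookup m j))" for A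
  proof (induction A rule: infinite_finite_induct)
    case (insert j A)
    have "keys (f j ^ lookup m j) \<subseteq> Q (w * lookup m j)"
      using insert.prems assms by (intro keys_power_graded) auto
    then show ?case
      using keys_mult_graded[OF assms(1)] insert by (simp add: distrib_left)
  qed (use assms(1) in \<open>auto simp: graded_monos_def\<close>)
  then show ?thesis by (simp add: mono_eval_def mdeg_def)
qed

lemma keys_Const_mult: "keys (Const c * p) \<subseteq> keys (p :: 'k::comm_ring_1 mpoly)"
proof -
  have "keys (Const c) \<subseteq> {0}"
    by (simp add: Const_def)
  then show ?thesis
    using keys_mult[of "Const c" p] by fastforce
qed

lemma keys_subst:
  "keys (subst f p) \<subseteq> (\<Union>m\<in>keys p. keys (mono_eval f m))"
proof -
  have "keys (subst f p) \<subseteq> (\<Union>m\<in>keys p. keys (Const (lookup p m) * mono_eval f m))"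
    unfolding subst_def by (rule keys_sum)
  then show ?thesis using keys_Const_mult by fastforce
qed

lemma keys_sum_subset: "(\<And>i. i \<in> A \<Longrightarrow> keys (f i) \<subseteq> S) \<Longrightarrow> keys (\<Sum>i\<in>A. f i) \<subseteq> S"
  using keys_sum[of f A] by blast

lemma keys_add_vars: "keys a \<subseteq> A \<Longrightarrow> keys b \<subseteq> A \<Longrightarrow> keys (a + b :: nat \<Rightarrow>\<^sub>0 nat) \<subseteq> A"
  using Poly_Mapping.keys_add[of a b] by blast

lemma graded_monos_forms: "graded_monos (\<lambda>t. {m. keys m \<subseteq> A \<and> mdeg m = t})"
  using keys_add_vars by (fastforce simp: graded_monos_def mdeg_add)

lemma graded_monos_le: "graded_monos (\<lambda>t. {m. keys m \<subseteq> A \<and> mdeg m \<le> t})"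
  using keys_add_vars by (fastforce simp: graded_monos_def mdeg_add)

lemma graded_monos_vars: "graded_monos (\<lambda>t. {m. keys m \<subseteq> A})"
  using keys_add_vars by (fastforce simp: graded_monos_def mdeg_add)

lemma forms_iff: "p \<in> forms n t \<longleftrightarrow> keys p \<subseteq> {m. keys m \<subseteq> {1..n} \<and> mdeg m = t}"
  by (auto simp: forms_def polys_def)

lemma polys_iff: "p \<in> polys n \<longleftrightarrow> keys p \<subseteq> {m. keys m \<subseteq> {1..n}}"
  by (auto simp: polys_def)

lemma subst_forms:
  assumes "\<And>j. j \<in> {1..n} \<Longrightarrow> f j \<in> forms n 1" "p \<in> forms n t"
  shows "subst f p \<in> forms n t"
proof -
  have "keys (mono_eval f m) \<subseteq> {m. keys m \<subseteq> {1..n} \<and> mdeg m = t}" if m: "m \<in> keys p" for m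
  proof -
    have m': "keys m \<subseteq> {1..n}" "mdeg m = t"
      using assms(2) m unfolding forms_iff by blast+
    have "keys (mono_eval f m) \<subseteq> {m'. keys m' \<subseteq> {1..n} \<and> mdeg m' = 1 * mdeg m}"
      using assms(1) m' unfolding forms_iff
      by (intro keys_mono_eval_graded[OF graded_monos_forms]) blast
    then show ?thesis using m' by simp
  qed
  then show ?thesis using keys_subst[of f p] unfolding forms_iff by blast
qed

lemma subst_polys:
  assumes "\<And>j. j \<in> {1..n} \<Longrightarrow> f j \<in> polys k" "p \<in> polys n"
  shows "subst f p \<in> polys k"
proof -
  have "keys (mono_eval f m) \<subseteq> {m. keys m \<subseteq> {1..k}}" if m: "m \<in> keys p" for m
    using assms m unfolding polys_iff
    by (intro keys_mono_eval_graded[OF graded_monos_vars]) blast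
  then show ?thesis using keys_subst[of f p] unfolding polys_iff by blast
qed

lemma forms_subset_polys: "forms n t \<subseteq> polys n"
  by (auto simp: forms_def)

lemma X_forms: "i \<in> {1..n} \<Longrightarrow> X i \<in> forms n 1"
  by (simp add: forms_iff X_def)

lemma X_polys: "i \<in> {1..n} \<Longrightarrow> X i \<in> polys n"
  using X_forms forms_subset_polys by blast

lemma single_polys: "keys m \<subseteq> {1..n} \<Longrightarrow> single m c \<in> polys n"
  by (simp add: polys_iff)

lemma Const_polys: "Const c \<in> polys n"
  by (simp add: Const_def single_polys)

lemma zero_polys: "0 \<in> polys n"
  by (simp add: polys_iff)

lemma polys_uminus: "p \<in> polys n \<Longrightarrow> - p \<in> polys n"
  by (auto simp: polys_def in_keys_iff)

text \<open>
  Index sets are written \<open>{1..n}\<close> throughout; the simplifier must not turn them into \<open>{Suc 0..n}\<close>.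
\<close>

declare One_nat_def [simp del]

section \<open>Ideals of the polynomial ring and monomial ideals\<close>

lemma poly_ring_simps [simp]:
  "carrier (poly_ring n) = polys n" "x \<otimes>\<^bsub>poly_ring n\<^esub> y = x * y" "x \<oplus>\<^bsub>poly_ring n\<^esub> y = x + y"
  "\<one>\<^bsub>poly_ring n\<^esub> = 1" "\<zero>\<^bsub>poly_ring n\<^esub> = 0"
  by (simp_all add: poly_ring_def)

interpretation poly_ring: cring "poly_ring n :: 'k::comm_ring_1 mpoly ring" for n
  by (rule cring_poly_ring)

lemma poly_ring_a_inv: "p \<in> polys n \<Longrightarrow> \<ominus>\<^bsub>poly_ring n\<^esub> p = - p"
  by (rule poly_ring.minus_equality) (simp_all add: polys_uminus)

lemma ideal_poly_ringI:
  fixes K :: "'k::comm_ring_1 mpoly set"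
  assumes "K \<subseteq> polys n" "0 \<in> K" "\<And>p q. p \<in> K \<Longrightarrow> q \<in> K \<Longrightarrow> p + q \<in> K"
    and mult: "\<And>r p. r \<in> polys n \<Longrightarrow> p \<in> K \<Longrightarrow> r * p \<in> K"
  shows "ideal K (poly_ring n)"
proof (rule idealI)
  show "ring (poly_ring n :: 'k mpoly ring)" by (rule poly_ring.ring_axioms)
  have neg: "- p \<in> K" if "p \<in> K" for p
    using mult[of "- 1" p] that polys_uminus[OF polys_one] by auto
  show "subgroup K (add_monoid (poly_ring n))"
  proof (rule poly_ring.add.subgroupI)
    show "\<ominus>\<^bsub>poly_ring n\<^esub> p \<in> K" if "p \<in> K" for p
      using that assms(1) neg by (simp add: poly_ring_a_inv subset_eq)
  qed (use assms in auto)
  have "p * r \<in> K" if "r \<in> polys n" "p \<in> K" for r p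
    using mult[OF that] by (simp add: mult.commute)
  then show "a \<otimes>\<^bsub>poly_ring n\<^esub> x \<in> K" if "a \<in> K" "x \<in> carrier (poly_ring n)" for a x
    using that by simp
qed (simp add: mult)

context
  fixes K :: "'k::comm_ring_1 mpoly set" and n :: nat
  assumes K: "ideal K (poly_ring n)"
begin

lemma ideal_subset_polys: "K \<subseteq> polys n"
  using additive_subgroup.a_subset[OF ideal.axioms(1)[OF K]] by simp

lemma ideal_zero: "0 \<in> K"
  using additive_subgroup.zero_closed[OF ideal.axioms(1)[OF K]] by simp

lemma ideal_add: "p \<in> K \<Longrightarrow> q \<in> K \<Longrightarrow> p + q \<in> K"
  using additive_subgroup.a_closed[OF ideal.axioms(1)[OF K]] by simp

lemma ideal_mult: "r \<in> polys n \<Longrightarrow> p \<in> K \<Longrightarrow> r * p \<in> K"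
  using ideal.I_l_closed[OF K] by simp

lemma ideal_diff: "p \<in> K \<Longrightarrow> q \<in> K \<Longrightarrow> p - q \<in> K"
  using ideal_add[of p "- 1 * q"] ideal_mult[of "- 1" q] polys_uminus[OF polys_one, where 'a = 'k] by simp

lemma ideal_sum: "(\<And>i. i \<in> A \<Longrightarrow> f i \<in> K) \<Longrightarrow> (\<Sum>i\<in>A. f i) \<in> K"
  by (induction A rule: infinite_finite_induct) (simp_all add: ideal_zero ideal_add)

end

lemma Idl_ideal: "S \<subseteq> polys n \<Longrightarrow> ideal (Idl\<^bsub>poly_ring n\<^esub> S) (poly_ring n)"
  by (rule poly_ring.genideal_ideal) simp

lemma Idl_self: "S \<subseteq> polys n \<Longrightarrow> S \<subseteq> Idl\<^bsub>poly_ring n\<^esub> S"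
  by (rule poly_ring.genideal_self) simp

lemma Idl_minimal: "ideal K (poly_ring n) \<Longrightarrow> S \<subseteq> K \<Longrightarrow> Idl\<^bsub>poly_ring n\<^esub> S \<subseteq> K"
  by (rule poly_ring.genideal_minimal)

lemma monomial_ideal_imp_ideal: "monomial_ideal n I \<Longrightarrow> ideal I (poly_ring n)"
  unfolding monomial_ideal_def using Idl_ideal single_polys by (metis image_subsetI)

lemma single_in_ideal:
  "ideal K (poly_ring n) \<Longrightarrow> single m 1 \<in> K \<Longrightarrow> single m c \<in> K"
  using ideal_mult[of K n "Const c" "single m 1"] by (simp add: Const_polys Const_mult_single)

lemma single_add_in_ideal:
  assumes "ideal K (poly_ring n)" "single m 1 \<in> K" "keys a \<subseteq> {1..n}"
  shows "single (a + m) 1 \<in> K"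
  using ideal_mult[OF assms(1) single_polys[OF assms(3), of 1] assms(2)] by (simp add: mult_single)

text \<open>
  The polynomials all of whose monomials lie in \<open>I\<close> form an ideal, and this ideal contains the
  monomial generators of \<open>I\<close>.
\<close>

lemma monomial_ideal_iff:
  fixes I :: "'k::field mpoly set"
  assumes "monomial_ideal n I"
  shows "p \<in> I \<longleftrightarrow> p \<in> polys n \<and> (\<forall>m\<in>keys p. single m 1 \<in> I)"
proof
  have I: "ideal I (poly_ring n)"
    using assms by (rule monomial_ideal_imp_ideal)
  {
    assume p: "p \<in> polys n \<and> (\<forall>m\<in>keys p. single m 1 \<in> I)"
    then have "(\<Sum>m\<in>keys p. single m (lookup p m)) \<in> I"
      by (intro ideal_sum[OF I]) (use single_in_ideal[OF I] in blast)
    then show "p \<in> I" by (simp add: sum_single_lookup)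
  }
  obtain M where M: "\<forall>m\<in>M. keys m \<subseteq> {1..n}" "I = Idl\<^bsub>poly_ring n\<^esub> ((\<lambda>m. single m 1) ` M)"
    using assms unfolding monomial_ideal_def by blast
  let ?G = "(\<lambda>m. single m (1::'k)) ` M"
  let ?K = "{p :: 'k mpoly. p \<in> polys n \<and> (\<forall>m\<in>keys p. single m 1 \<in> I)}"
  have G: "?G \<subseteq> polys n" using M(1) single_polys by blast
  have "ideal ?K (poly_ring n)"
  proof (rule ideal_poly_ringI)
    fix p q :: "'k mpoly" assume "p \<in> ?K" "q \<in> ?K"
    then show "p + q \<in> ?K"
      using Poly_Mapping.keys_add[of p q] polys_add[of p n q] by blast
  next
    fix r p :: "'k mpoly" assume r: "r \<in> polys n" and p: "p \<in> ?K"
    have "single m 1 \<in> I" if m: "m \<in> keys (r * p)" for m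
    proof -
      obtain a b where "m = a + b" "a \<in> keys r" "b \<in> keys p"
        using keys_mult[of r p] m by blast
      then show ?thesis
        using single_add_in_ideal[OF I, of b a] r p by (simp add: polys_def)
    qed
    then show "r * p \<in> ?K" using r p polys_mult by blast
  qed (auto simp: zero_polys)
  moreover have "?G \<subseteq> ?K"
    using G Idl_self[OF G] M(2) by auto
  ultimately have "I \<subseteq> ?K"
    using Idl_minimal M(2) by blast
  then show "p \<in> I \<Longrightarrow> p \<in> polys n \<and> (\<forall>m\<in>keys p. single m 1 \<in> I)" by blast
qed

section \<open>The action of the Borel group\<close>

text \<open>
  By induction on the column \<open>j\<close>: below the diagonal the entry of \<open>h * g = 1\<close> at \<open>(i, j)\<close> reduces to
  \<open>h\<^sub>i\<^sub>j g\<^sub>j\<^sub>j\<close>, since the earlier columns of \<open>h\<close> vanish below the diagonal and \<open>g\<close> is upper triangular.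
\<close>

lemma inverse_upper_triangular:
  fixes g h :: "'k::field mat"
  assumes g: "g \<in> carrier_mat n n" "upper_triangular g" "\<And>i. i < n \<Longrightarrow> g $$ (i, i) \<noteq> 0"
    and h: "h \<in> carrier_mat n n" "h * g = 1\<^sub>m n"
  shows "upper_triangular h"
proof (rule upper_triangularI)
  fix i j assume "j < i" "i < dim_row h"
  then show "h $$ (i, j) = 0"
  proof (induction j rule: less_induct)
    case (less j)
    then have ij: "i < n" "j < n" using h(1) by auto
    have "0 = (h * g) $$ (i, j)"
      using h(2) ij less.prems by simp
    also have "\<dots> = (\<Sum>k<n. h $$ (i, k) * g $$ (k, j))"
      using ij g(1) h(1) by (simp add: scalar_prod_def atLeast0LessThan)
    also have "\<dots> = (\<Sum>k\<in>{j}. h $$ (i, k) * g $$ (k, j))"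
    proof (rule sum.mono_neutral_right)
      show "\<forall>k\<in>{..<n} - {j}. h $$ (i, k) * g $$ (k, j) = 0"
      proof
        fix k assume "k \<in> {..<n} - {j}"
        then consider "k < j" | "j < k" "k < n" by force
        then show "h $$ (i, k) * g $$ (k, j) = 0"
        proof cases
          case 1
          then show ?thesis using less.IH[of k] less.prems by simp
        next
          case 2
          then show ?thesis using upper_triangularD[OF g(2)] g(1) by simp
        qed
      qed
    qed (use ij in auto)
    finally show ?case using g(3)[OF ij(2)] by simp
  qed
qed

lemma unitriangular_borel:
  fixes g :: "'k::field mat"
  assumes g: "g \<in> carrier_mat n n" "upper_triangular g" "\<And>i. i < n \<Longrightarrow> g $$ (i, i) = 1"
  obtains h where "g \<in> borel n" "h \<in> borel n" "h * g = 1\<^sub>m n" "g * h = 1\<^sub>m n"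
proof -
  have "diag_mat g = map (\<lambda>i. 1) [0..<n]"
    using g(1,3) by (auto simp: diag_mat_def)
  moreover have "prod_list (map (\<lambda>i. 1 :: 'k) [0..<n]) = 1"
    by (induction n) auto
  ultimately have "det g = 1"
    using det_upper_triangular[OF g(2,1)] by simp
  then have "g \<in> Units (ring_mat TYPE('k) n ())"
    using det_non_zero_imp_unit[OF g(1)] by simp
  then obtain h where h: "h \<in> carrier_mat n n" "h * g = 1\<^sub>m n" "g * h = 1\<^sub>m n"
    unfolding Units_def by (auto simp: ring_mat_simps)
  have "upper_triangular h"
    by (rule inverse_upper_triangular[OF g(1,2) _ h(1,2)]) (simp add: g(3))
  then have "g \<in> borel n" "h \<in> borel n"
    using g h unfolding borel_def invertible_mat_def inverts_mat_def by auto
  then show ?thesis using h that by blast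
qed

text \<open>
  Upper triangularity allows the sum to run over all variables, which is the shape in which composition
  of substitutions becomes a matrix product.
\<close>

lemma act_var_borel:
  assumes "g \<in> borel n" "j \<in> {1..n}"
  shows "act_var g j = (\<Sum>i=1..n. Const (g $$ (i - 1, j - 1)) * X i)"
  unfolding act_var_def
proof (rule sum.mono_neutral_left)
  show "\<forall>i\<in>{1..n} - {1..j}. Const (g $$ (i - 1, j - 1)) * X i = 0"
  proof
    fix i assume "i \<in> {1..n} - {1..j}"
    then have "j - 1 < i - 1" "i - 1 < n" using assms(2) by auto
    then show "Const (g $$ (i - 1, j - 1)) * X i = 0"
      using assms(1) upper_triangularD[of g] by (auto simp: borel_def)
  qed
qed (use assms in auto)

lemma linear_form_forms: "(\<And>i. i \<in> A \<Longrightarrow> f i \<in> forms n t) \<Longrightarrow> (\<Sum>i\<in>A. Const (c i) * f i) \<in> forms n t"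
  unfolding forms_iff
  by (intro keys_sum_subset) (use keys_Const_mult in blast)

lemma act_var_forms: "j \<in> {1..n} \<Longrightarrow> act_var g j \<in> forms n 1"
  unfolding act_var_def by (intro linear_form_forms X_forms) auto

lemma act_forms: "p \<in> forms n t \<Longrightarrow> act g p \<in> forms n t"
  unfolding act_eq_subst by (rule subst_forms) (rule act_var_forms)

lemma act_polys: "p \<in> polys n \<Longrightarrow> act g p \<in> polys n"
  unfolding act_eq_subst
  by (rule subst_polys) (use act_var_forms forms_subset_polys in blast)

text \<open>
  The composite substitution sends \<open>x\<^sub>j\<close> to the linear form whose coefficients are column \<open>j\<close> of \<open>h * g\<close>.
\<close>

lemma act_inverse:
  fixes g h :: "'k::field mat"
  assumes g: "g \<in> borel n" and h: "h \<in> borel n" and hg: "h * g = 1\<^sub>m n" and p: "p \<in> polys n"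
  shows "act h (act g p) = p"
proof -
  have "act h (act_var g j) = X j" if j: "j \<in> {1..n}" for j
  proof -
    have entry: "(\<Sum>i=1..n. h $$ (k - 1, i - 1) * g $$ (i - 1, j - 1)) = (if k = j then 1 else 0)"
      if k: "k \<in> {1..n}" for k
    proof -
      have "(\<Sum>i=1..n. h $$ (k - 1, i - 1) * g $$ (i - 1, j - 1)) = (h * g) $$ (k - 1, j - 1)"
        using g h j k by (auto simp: borel_def scalar_prod_def atLeast0LessThan sum.atLeast1_atMost_eq[unfolded One_nat_def[symmetric]])
      then show ?thesis using j k by (auto simp: hg)
    qed
    have "act h (act_var g j) = (\<Sum>i=1..n. Const (g $$ (i - 1, j - 1)) * act_var h i)"
      by (simp add: act_var_borel[OF g j] act_eq_subst subst_sum subst_mult)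
    also have "\<dots> = (\<Sum>i=1..n. \<Sum>k=1..n. Const (h $$ (k - 1, i - 1) * g $$ (i - 1, j - 1)) * X k)"
      by (intro sum.cong refl) (simp add: act_var_borel[OF h] sum_distrib_left Const_mult mult_ac)
    also have "\<dots> = (\<Sum>k=1..n. Const (\<Sum>i=1..n. h $$ (k - 1, i - 1) * g $$ (i - 1, j - 1)) * X k)"
      by (subst sum.swap) (simp add: Const_sum sum_distrib_right)
    also have "\<dots> = (\<Sum>k=1..n. (if k = j then X j else 0))"
      by (intro sum.cong refl) (simp add: entry del: One_nat_def)
    finally show ?thesis using j by simp
  qed
  then have "act h (act g p) = subst X p"
    using p unfolding act_eq_subst subst_subst polys_def by (intro subst_cong) blast
  then show ?thesis by (simp add: subst_X_ident)
qed

lemma add_power_split: "\<exists>q. (x + y) ^ e = (x :: 'a::comm_ring_1) ^ e + y * q"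
proof (induction e)
  case (Suc e)
  then obtain q where "(x + y) ^ e = x ^ e + y * q" ..
  then have "(x + y) ^ Suc e = x ^ Suc e + y * (x * q + x ^ e + y * q)"
    by (simp add: algebra_simps)
  then show ?case ..
qed (auto intro: exI[of _ 0])

text \<open>
  Apply the elementary substitution \<open>x\<^sub>j \<mapsto> x\<^sub>i + x\<^sub>j\<close>.  The image of \<open>r x\<^sub>j\<^sup>a\<close> is \<open>r x\<^sub>i\<^sup>a\<close> plus terms
  that are divisible by \<open>x\<^sub>j\<close>.  As \<open>r\<close> is free of \<open>x\<^sub>j\<close>, nothing cancels \<open>r x\<^sub>i\<^sup>a\<close>, in any characteristic.
\<close>

lemma borel_fixed_move:
  fixes I :: "'k::field mpoly set"
  assumes "borel_fixed n I" "1 \<le> i" "i < j" "j \<le> n" "j \<notin> keys r" "keys r \<subseteq> {1..n}"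
    and "single (r + single j a) 1 \<in> I"
  shows "single (r + single i a) 1 \<in> I"
proof -
  have I: "monomial_ideal n I" and fix_I: "\<And>g. g \<in> borel n \<Longrightarrow> act g ` I = I"
    using assms(1) unfolding borel_fixed_def by blast+
  define g :: "'k mat" where
    "g = mat n n (\<lambda>(k, l). if k = l \<or> (k = i - 1 \<and> l = j - 1) then 1 else 0)"
  have "g \<in> carrier_mat n n" "\<And>k. k < n \<Longrightarrow> g $$ (k, k) = 1"
    by (auto simp: g_def)
  moreover have "upper_triangular g"
    by (rule upper_triangularI) (use assms(2-4) in \<open>auto simp: g_def\<close>)
  ultimately have g: "g \<in> borel n" using unitriangular_borel by metis
  have var: "act_var g l = X l" if "l \<noteq> j" "l \<in> {1..n}" for l
  proof -
    have "act_var g l = (\<Sum>k=1..n. if k = l then X l else 0)"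
      unfolding act_var_borel[OF g that(2)]
      by (intro sum.cong refl) (use that assms(2-4) in \<open>auto simp: g_def\<close>)
    then show ?thesis using that by simp
  qed
  have varj: "act_var g j = X i + X j"
  proof -
    have j: "j \<in> {1..n}" using assms(2-4) by simp
    have "act_var g j = (\<Sum>k=1..n. (if k = i then X i else 0) + (if k = j then X j else 0))"
      unfolding act_var_borel[OF g j]
      by (intro sum.cong refl) (use assms(2-4) in \<open>auto simp: g_def\<close>)
    then show ?thesis using assms(2-4) by (simp add: sum.distrib)
  qed
  have "mono_eval (act_var g) r = mono_eval X r"
    using assms(5,6) by (intro mono_eval_cong var) auto
  then have "act g (single (r + single j a) 1) = single r 1 * (X i + X j) ^ a"
    by (simp add: act_eq_subst subst_single mono_eval_add mono_eval_single mono_eval_X varj)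
  moreover obtain q :: "'k mpoly" where "(X i + X j) ^ a = X i ^ a + X j * q"
    using add_power_split by blast
  ultimately have act: "act g (single (r + single j a) 1)
      = single (r + single i a) 1 + single (r + single j 1) 1 * q"
    by (simp add: distrib_left X_power mult_single X_def[of j] flip: mult.assoc)
  \<comment> \<open>The terms produced by \<open>x\<^sub>j\<close> are divisible by \<open>x\<^sub>j\<close>, so they cannot cancel the wanted monomial.\<close>
  have "r + single i a \<notin> keys (single (r + single j 1) 1 * q)"
  proof
    assume "r + single i a \<in> keys (single (r + single j 1) 1 * q)"
    then obtain b where b: "r + single i a = r + single j 1 + b"
      using keys_mult[of "single (r + single j 1) 1" q] by auto
    have "lookup (r + single i a) j = 0" using assms(3,5)
      by (simp add: lookup_add lookup_single in_keys_iff)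
    moreover have "lookup (r + single j 1 + b) j > 0"
      by (simp add: lookup_add)
    ultimately show False using b by simp
  qed
  then have "r + single i a \<in> keys (act g (single (r + single j a) 1))"
    unfolding act by (simp add: in_keys_iff lookup_add)
  moreover have "act g (single (r + single j a) 1) \<in> I"
    using fix_I[OF g] assms(7) by blast
  ultimately show ?thesis
    using monomial_ideal_iff[OF I] by blast
qed

section \<open>Linear systems and echelon bases\<close>

text \<open>
  Gaussian elimination: an equation in which some unknown occurs is solved for that unknown and
  substituted into the others, which removes one equation and one unknown.
\<close>

lemma homogeneous_system:
  fixes a :: "'i \<Rightarrow> 'j \<Rightarrow> 'k::field"
  assumes "finite B" "finite A" "card B < card A"
  shows "\<exists>x. (\<exists>i\<in>A. x i \<noteq> 0) \<and> (\<forall>j\<in>B. (\<Sum>i\<in>A. x i * a i j) = 0)"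
  using assms
proof (induction B arbitrary: A a rule: finite_induct)
  case empty
  then show ?case by (intro exI[of _ "\<lambda>_. 1"]) (auto simp: card_gt_0_iff)
next
  case (insert j B)
  show ?case
  proof (cases "\<forall>i\<in>A. a i j = 0")
    case True
    then show ?thesis using insert.IH[of A a] insert by auto
  next
    case False
    then obtain i0 where i0: "i0 \<in> A" "a i0 j \<noteq> 0" by blast
    define a' where "a' i k = a i k - a i j / a i0 j * a i0 k" for i k
    have "card B < card (A - {i0})"
      using insert.prems insert.hyps i0 by simp
    then obtain x where x: "\<exists>i\<in>A - {i0}. x i \<noteq> 0" "\<forall>k\<in>B. (\<Sum>i\<in>A - {i0}. x i * a' i k) = 0"
      using insert.IH[of "A - {i0}" a'] insert.prems by auto
    define x' where "x' = x(i0 := - (\<Sum>i\<in>A - {i0}. x i * (a i j / a i0 j)))"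
    have "(\<Sum>i\<in>A. x' i * a i k) = (\<Sum>i\<in>A - {i0}. x i * a' i k)" for k
    proof -
      have "(\<Sum>i\<in>A. x' i * a i k) = x' i0 * a i0 k + (\<Sum>i\<in>A - {i0}. x' i * a i k)"
        using insert.prems i0 by (intro sum.remove) auto
      also have "(\<Sum>i\<in>A - {i0}. x' i * a i k) = (\<Sum>i\<in>A - {i0}. x i * a i k)"
        by (intro sum.cong) (auto simp: x'_def)
      finally show ?thesis
        by (simp add: x'_def a'_def right_diff_distrib sum_subtractf sum_distrib_right mult.assoc)
    qed
    moreover have "(\<Sum>i\<in>A - {i0}. x i * a' i j) = 0"
      using i0 by (simp add: a'_def)
    ultimately have "\<forall>k\<in>insert j B. (\<Sum>i\<in>A. x' i * a i k) = 0"
      using x(2) by simp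
    moreover have "\<exists>i\<in>A. x' i \<noteq> 0"
      using x(1) by (auto simp: x'_def)
    ultimately show ?thesis by blast
  qed
qed

text \<open>
  \<open>J\<close> is the set of largest positions in \<open>{1..n}\<close> of nonzero entries of combinations of the vectors, and \<open>b j\<close> is a
  combination with leading entry 1 at \<open>j\<close>.  Subtracting multiples of the \<open>b j\<close> lowers the leading position, so
  the \<open>b j\<close> span; distinct leading positions make them independent.  Both statements about \<open>card J\<close> then
  follow from \<open>homogeneous_system\<close>.
\<close>

lemma echelon_basis:
  fixes v :: "nat \<Rightarrow> nat \<Rightarrow> 'k::field"
  obtains J b where "J \<subseteq> {1..n}" "\<forall>j\<in>J. b j j = 1 \<and> (\<forall>i\<in>{j<..n}. b j i = 0)"
    "\<forall>j\<in>J. \<exists>c. \<forall>i\<in>{1..n}. b j i = (\<Sum>r=1..s. c r * v r i)"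
    "\<forall>r\<in>{1..s}. \<exists>e. \<forall>i\<in>{1..n}. v r i = (\<Sum>j\<in>J. e j * b j i)"
    "card J \<le> s"
    "(\<forall>c. (\<forall>i\<in>{1..n}. (\<Sum>r=1..s. c r * v r i) = 0) \<longrightarrow> (\<forall>r\<in>{1..s}. c r = 0)) \<longrightarrow> card J = s"
proof -
  define comb where "comb c i = (\<Sum>r=1..s. c r * v r i)" for c :: "nat \<Rightarrow> 'k" and i
  define lead where "lead c j \<longleftrightarrow> j \<in> {1..n} \<and> comb c j = 1 \<and> (\<forall>i\<in>{j<..n}. comb c i = 0)" for c j
  define J where "J = {j. \<exists>c. lead c j}"
  define C where "C j = (SOME c. lead c j)" for j
  define b where "b j = comb (C j)" for j
  have J: "J \<subseteq> {1..n}" by (auto simp: J_def lead_def)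
  then have fin: "finite J" by (rule finite_subset) simp
  have C: "lead (C j) j" if "j \<in> J" for j
    using that someI_ex[of "\<lambda>c. lead c j"] by (simp add: J_def C_def)
  have b1: "b j j = 1" if "j \<in> J" for j
    using C[OF that] by (simp add: lead_def b_def)
  have b0: "b j i = 0" if "j \<in> J" "j < i" "i \<le> n" for j i
    using C[OF that(1)] that by (simp add: lead_def b_def)
  have scale: "comb (\<lambda>r. x * c r) i = x * comb c i" for x c i
    by (simp add: comb_def sum_distrib_left mult.assoc)
  have diff: "comb (\<lambda>r. c r - x * c' r) i = comb c i - x * comb c' i" for x c c' i
    by (simp add: comb_def sum_distrib_left sum_subtractf left_diff_distrib mult.assoc)
  have span: "k \<le> n \<Longrightarrow> (\<forall>i\<in>{k<..n}. comb c i = 0) \<Longrightarrow> \<exists>e. \<forall>i\<in>{1..n}. comb c i = (\<Sum>j\<in>J. e j * b j i)" for k c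
  proof (induction k arbitrary: c)
    case 0
    then show ?case by (intro exI[of _ "\<lambda>_. 0"]) auto
  next
    case (Suc k)
    let ?x = "comb c (Suc k)"
    show ?case
    proof (cases "?x = 0")
      case True
      have "comb c i = 0" if "i \<in> {k<..n}" for i
        using that Suc.prems True by (cases "i = Suc k") auto
      then show ?thesis using Suc.IH[of c] Suc.prems by auto
    next
      case False
      have "lead (\<lambda>r. inverse ?x * c r) (Suc k)"
        unfolding lead_def scale using False Suc.prems by auto
      then have kJ: "Suc k \<in> J" unfolding J_def by blast
      let ?c = "\<lambda>r. c r - ?x * C (Suc k) r"
      have c': "comb ?c i = comb c i - ?x * b (Suc k) i" for i
        by (simp add: diff b_def)
      have "comb ?c i = 0" if "i \<in> {k<..n}" for i
        using that Suc.prems b1[OF kJ] b0[OF kJ, of i] unfolding c' by (cases "i = Suc k") auto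
      then obtain e where e: "\<forall>i\<in>{1..n}. comb ?c i = (\<Sum>j\<in>J. e j * b j i)"
        using Suc.IH[of ?c] Suc.prems by auto
      have "comb c i = (\<Sum>j\<in>J. (e j + (if j = Suc k then ?x else 0)) * b j i)" if "i \<in> {1..n}" for i
      proof -
        have "comb c i = (\<Sum>j\<in>J. e j * b j i) + ?x * b (Suc k) i"
          using e that c'[of i] by simp
        also have "?x * b (Suc k) i = (\<Sum>j\<in>J. if j = Suc k then ?x * b (Suc k) i else 0)"
          using kJ fin by simp
        finally show ?thesis
          by (simp add: distrib_right sum.distrib if_distrib[of "\<lambda>y. y * _"] cong: if_cong)
      qed
      then show ?thesis
        by (intro exI[of _ "\<lambda>j. e j + (if j = Suc k then ?x else 0)"] ballI)
    qed
  qed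
  have indep: "x j = 0" if x: "\<forall>i\<in>{1..n}. (\<Sum>j\<in>J. x j * b j i) = 0" and j: "j \<in> J" for x j
  proof (rule ccontr)
    assume "x j \<noteq> 0"
    define m where "m = Max {j \<in> J. x j \<noteq> 0}"
    have m: "m \<in> J" "x m \<noteq> 0" "\<And>j. j \<in> J \<Longrightarrow> x j \<noteq> 0 \<Longrightarrow> j \<le> m"
      using Max_in[of "{j \<in> J. x j \<noteq> 0}"] fin j \<open>x j \<noteq> 0\<close> by (auto simp: m_def)
    have "(\<Sum>j\<in>J. x j * b j m) = (\<Sum>j\<in>{m}. x j * b j m)"
    proof (rule sum.mono_neutral_right)
      show "\<forall>j\<in>J - {m}. x j * b j m = 0"
        using m(3) b0[of _ m] m(1) J by (metis DiffE atLeastAtMost_iff insertCI le_neq_implies_less mult_eq_0_iff subset_iff)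
    qed (use fin m in auto)
    then show False using x m J b1 by auto
  qed
  have bC: "(\<Sum>j\<in>J. x j * b j i) = (\<Sum>r=1..s. (\<Sum>j\<in>J. x j * C j r) * v r i)" for x i
    unfolding b_def comb_def sum_distrib_left sum_distrib_right
    by (subst sum.swap) (simp add: mult.assoc)
  have le: "card J \<le> s"
  proof (rule ccontr)
    assume "\<not> card J \<le> s"
    then obtain x where "\<exists>j\<in>J. x j \<noteq> 0" "\<forall>r\<in>{1..s}. (\<Sum>j\<in>J. x j * C j r) = 0"
      using homogeneous_system[of "{1..s}" J C] fin by auto
    then show False using indep[of x] bC[of x] by auto
  qed
  have v: "\<exists>e. \<forall>i\<in>{1..n}. v r i = (\<Sum>j\<in>J. e j * b j i)" if r: "r \<in> {1..s}" for r
  proof -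
    have "comb (\<lambda>r'. if r' = r then 1 else 0) i = v r i" for i
      using r by (simp add: comb_def if_distrib[of "\<lambda>y. y * _"] cong: if_cong)
    then show ?thesis using span[of n "\<lambda>r'. if r' = r then 1 else 0"] by simp
  qed
  have eq: "card J = s"
    if ind: "\<And>c. (\<forall>i\<in>{1..n}. (\<Sum>r=1..s. c r * v r i) = 0) \<Longrightarrow> \<forall>r\<in>{1..s}. c r = 0"
  proof (rule ccontr)
    assume "card J \<noteq> s"
    then have "card J < card {1..s}" using le by simp
    obtain e where e: "\<forall>r\<in>{1..s}. \<forall>i\<in>{1..n}. v r i = (\<Sum>j\<in>J. e r j * b j i)"
      using v by metis
    obtain x where x: "\<exists>r\<in>{1..s}. x r \<noteq> 0" "\<forall>j\<in>J. (\<Sum>r=1..s. x r * e r j) = 0"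
      using homogeneous_system[of J "{1..s}" e] fin \<open>card J < card {1..s}\<close> by auto
    have "(\<Sum>r=1..s. x r * v r i) = 0" if i: "i \<in> {1..n}" for i
    proof -
      have "(\<Sum>r=1..s. x r * v r i) = (\<Sum>r=1..s. \<Sum>j\<in>J. x r * e r j * b j i)"
        using e i by (intro sum.cong refl) (simp add: sum_distrib_left mult.assoc)
      also have "\<dots> = (\<Sum>j\<in>J. (\<Sum>r=1..s. x r * e r j) * b j i)"
        by (subst sum.swap) (simp add: sum_distrib_right)
      finally show ?thesis using x(2) by simp
    qed
    then show False using ind[of x] x(1) by blast
  qed
  show thesis
  proof (rule that[OF J _ _ _ le])
    show "\<forall>j\<in>J. b j j = 1 \<and> (\<forall>i\<in>{j<..n}. b j i = 0)" using b1 b0 by simp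
    show "\<forall>j\<in>J. \<exists>c. \<forall>i\<in>{1..n}. b j i = (\<Sum>r=1..s. c r * v r i)"
      by (auto simp: b_def comb_def)
    show "\<forall>r\<in>{1..s}. \<exists>e. \<forall>i\<in>{1..n}. v r i = (\<Sum>j\<in>J. e j * b j i)" using v by blast
  qed (use eq in blast)
qed

section \<open>Ideals and reductions of the quotient algebra\<close>

abbreviation quot_ring :: "nat \<Rightarrow> 'k::field mpoly set \<Rightarrow> 'k mpoly set ring" where
  "quot_ring n I \<equiv> poly_ring n Quot I"

abbreviation proj :: "nat \<Rightarrow> 'k::field mpoly set \<Rightarrow> 'k mpoly \<Rightarrow> 'k mpoly set" where
  "proj n I p \<equiv> I +>\<^bsub>poly_ring n\<^esub> p"

context
  fixes n :: nat and I :: "'k::field mpoly set"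
  assumes I: "ideal I (poly_ring n)"
begin

lemma proj_carrier: "p \<in> polys n \<Longrightarrow> proj n I p \<in> carrier (quot_ring n I)"
  using ring_hom_closed[OF ideal.rcos_ring_hom[OF I]] by simp

lemma proj_eq: "proj n I p = {i + p |i. i \<in> I}"
  by (auto simp: a_r_coset_def')

lemma proj_self: "p \<in> proj n I p"
  using ideal_zero[OF I] by (auto simp: proj_eq)

lemma proj_zero: "p \<in> I \<Longrightarrow> proj n I p = \<zero>\<^bsub>quot_ring n I\<^esub>"
proof -
  assume p: "p \<in> I"
  have "x \<in> proj n I p" if "x \<in> I" for x
    using ideal_diff[OF I that p] unfolding proj_eq by (auto intro!: exI[of _ "x - p"])
  then show ?thesis
    using ideal_add[OF I _ p] by (auto simp: FactRing_def proj_eq)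
qed

lemma proj_image_iff:
  assumes "ideal K (poly_ring n)" "I \<subseteq> K" "p \<in> polys n"
  shows "proj n I p \<in> proj n I ` K \<longleftrightarrow> p \<in> K"
proof
  assume "proj n I p \<in> proj n I ` K"
  then obtain k where k: "k \<in> K" "proj n I p = proj n I k" by blast
  have "p \<in> proj n I k"
    using proj_self[of p] k(2) by simp
  then obtain i where "i \<in> I" "p = i + k"
    by (auto simp: proj_eq)
  then show "p \<in> K" using k assms ideal_add by blast
qed blast

text \<open>
  Both inclusions are minimality of a generated ideal, applied to the image of an ideal of the
  polynomial ring on one side and to the preimage of an ideal of the quotient on the other.
\<close>

lemma Idl_quot:
  assumes S: "S \<subseteq> polys n"
  shows "Idl\<^bsub>quot_ring n I\<^esub> (proj n I ` S) = proj n I ` (Idl\<^bsub>poly_ring n\<^esub> (S \<union> I))"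
proof
  have SI: "S \<union> I \<subseteq> polys n" using S ideal_subset_polys[OF I] by blast
  have ring: "ring (quot_ring n I)" by (rule ideal.quotient_is_ring[OF I])
  have "ideal (proj n I ` (Idl\<^bsub>poly_ring n\<^esub> (S \<union> I))) (quot_ring n I)"
    by (rule poly_ring.ring_ideal_imp_quot_ideal[OF I Idl_ideal[OF SI]])
  then show "Idl\<^bsub>quot_ring n I\<^esub> (proj n I ` S) \<subseteq> proj n I ` (Idl\<^bsub>poly_ring n\<^esub> (S \<union> I))"
    by (rule ring.genideal_minimal[OF ring]) (use Idl_self[OF SI] in blast)
  let ?K = "Idl\<^bsub>quot_ring n I\<^esub> (proj n I ` S)"
  have pS: "proj n I ` S \<subseteq> carrier (quot_ring n I)" using S proj_carrier by blast
  have K: "ideal ?K (quot_ring n I)" by (rule ring.genideal_ideal[OF ring pS])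
  have "ideal {r \<in> carrier (poly_ring n). proj n I r \<in> ?K} (poly_ring n)"
    by (rule ring_hom_ring.ideal_vimage[OF ideal.rcos_ring_hom_ring[OF I] K])
  moreover have "S \<union> I \<subseteq> {r \<in> carrier (poly_ring n). proj n I r \<in> ?K}"
  proof
    fix p assume p: "p \<in> S \<union> I"
    have "proj n I p \<in> ?K"
    proof (cases "p \<in> S")
      case True
      then show ?thesis using ring.genideal_self[OF ring pS] by blast
    next
      case False
      then have "proj n I p = \<zero>\<^bsub>quot_ring n I\<^esub>" using p proj_zero by blast
      then show ?thesis using additive_subgroup.zero_closed[OF ideal.axioms(1)[OF K]] by simp
    qed
    then show "p \<in> {r \<in> carrier (poly_ring n). proj n I r \<in> ?K}" using p SI by auto
  qed
  ultimately have "Idl\<^bsub>poly_ring n\<^esub> (S \<union> I) \<subseteq> {r \<in> carrier (poly_ring n). proj n I r \<in> ?K}"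
    by (rule Idl_minimal)
  then show "proj n I ` (Idl\<^bsub>poly_ring n\<^esub> (S \<union> I)) \<subseteq> ?K" by blast
qed

lemma quot_ideal_Idl:
  assumes S: "S \<subseteq> polys n"
  shows "quot_ideal n I (Idl\<^bsub>poly_ring n\<^esub> S) = Idl\<^bsub>quot_ring n I\<^esub> (proj n I ` S)"
proof -
  let ?Id = "\<lambda>S. Idl\<^bsub>poly_ring n\<^esub> S"
  have SI: "S \<union> I \<subseteq> polys n" using S ideal_subset_polys[OF I] by blast
  have IS: "?Id S \<subseteq> polys n" by (rule ideal_subset_polys[OF Idl_ideal[OF S]])
  then have ISI: "?Id S \<union> I \<subseteq> polys n" using SI by blast
  have "?Id S \<subseteq> ?Id (S \<union> I)"
    by (rule Idl_minimal[OF Idl_ideal[OF SI]]) (use Idl_self[OF SI] in blast)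
  then have "?Id (?Id S \<union> I) \<subseteq> ?Id (S \<union> I)"
    by (intro Idl_minimal[OF Idl_ideal[OF SI]]) (use Idl_self[OF SI] in blast)
  moreover have "?Id (S \<union> I) \<subseteq> ?Id (?Id S \<union> I)"
    by (intro Idl_minimal[OF Idl_ideal[OF ISI]]) (use Idl_self[OF ISI] Idl_self[OF S] in blast)
  ultimately show ?thesis
    unfolding quot_ideal_def Idl_quot[OF S] Idl_quot[OF IS] by simp
qed

end

text \<open>
  This says \<open>\<qq>\<^sub>t = A\<^sub>t\<close> for \<open>A = R/I\<close> and the ideal \<open>\<qq>\<close> of \<open>A\<close> generated by \<open>S\<close>, but in terms of ideals of
  the polynomial ring.
\<close>

definition covers :: "nat \<Rightarrow> 'k::field mpoly set \<Rightarrow> 'k mpoly set \<Rightarrow> nat \<Rightarrow> bool" where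
  "covers n I S t \<longleftrightarrow> forms n t \<subseteq> Idl\<^bsub>poly_ring n\<^esub> (S \<union> I)"

lemma covers_iff:
  assumes I: "ideal I (poly_ring n)" and S: "S \<subseteq> polys n"
  shows "Idl\<^bsub>quot_ring n I\<^esub> (proj n I ` S) \<inter> quot_gr n I t = quot_gr n I t \<longleftrightarrow> covers n I S t"
proof -
  have SI: "S \<union> I \<subseteq> polys n" using S ideal_subset_polys[OF I] by blast
  have "proj n I p \<in> proj n I ` (Idl\<^bsub>poly_ring n\<^esub> (S \<union> I)) \<longleftrightarrow> p \<in> Idl\<^bsub>poly_ring n\<^esub> (S \<union> I)"
    if "p \<in> forms n t" for p
  proof (rule proj_image_iff[OF I Idl_ideal[OF SI]])
    show "p \<in> polys n" using that forms_subset_polys by blast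
  qed (use Idl_self[OF SI] in simp)
  then have "quot_gr n I t \<subseteq> proj n I ` (Idl\<^bsub>poly_ring n\<^esub> (S \<union> I)) \<longleftrightarrow> covers n I S t"
    unfolding covers_def quot_gr_def image_subset_iff by (simp add: subset_eq)
  then show ?thesis
    unfolding Idl_quot[OF I S] by (simp add: Int_absorb1 inf.absorb_iff2)
qed

lemma reduction_number_covers:
  assumes I: "ideal I (poly_ring n)" and S: "S \<subseteq> polys n"
  shows "reduction_number (quot_gr n I) (Idl\<^bsub>quot_ring n I\<^esub> (proj n I ` S)) = (LEAST r. covers n I S (r + 1))"
  unfolding reduction_number_def covers_iff[OF I S] ..

lemma s_reduction_covers:
  assumes I: "ideal I (poly_ring n)" and l: "\<And>j. j \<in> {1..s} \<Longrightarrow> l j \<in> forms n 1"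
  shows "s_reduction (quot_ring n I) (quot_gr n I) s (Idl\<^bsub>quot_ring n I\<^esub> (proj n I ` l ` {1..s}))
    \<longleftrightarrow> (\<exists>t0. \<forall>t\<ge>t0. covers n I (l ` {1..s}) t)"
proof -
  have S: "l ` {1..s} \<subseteq> polys n" using l forms_subset_polys by blast
  have "\<exists>z. (\<forall>j\<in>{1..s}. z j \<in> quot_gr n I 1) \<and>
      Idl\<^bsub>quot_ring n I\<^esub> (proj n I ` l ` {1..s}) = Idl\<^bsub>quot_ring n I\<^esub> (z ` {1..s})"
    using l by (intro exI[of _ "\<lambda>j. proj n I (l j)"]) (auto simp: quot_gr_def image_image)
  then show ?thesis
    unfolding s_reduction_def covers_iff[OF I S] by blast
qed

lemma s_reduction_lift:
  assumes I: "ideal I (poly_ring n)" and q: "s_reduction (quot_ring n I) (quot_gr n I) s q"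
  obtains l where "\<And>j. j \<in> {1..s} \<Longrightarrow> l j \<in> forms n 1"
    "q = Idl\<^bsub>quot_ring n I\<^esub> (proj n I ` l ` {1..s})"
proof -
  obtain z where z: "\<forall>j\<in>{1..s}. z j \<in> quot_gr n I 1" "q = Idl\<^bsub>quot_ring n I\<^esub> (z ` {1..s})"
    using q unfolding s_reduction_def by blast
  then have "\<forall>j\<in>{1..s}. \<exists>p. p \<in> forms n 1 \<and> z j = proj n I p"
    unfolding quot_gr_def by blast
  then obtain l where l: "\<forall>j\<in>{1..s}. l j \<in> forms n 1 \<and> z j = proj n I (l j)"
    by metis
  then have "z ` {1..s} = proj n I ` l ` {1..s}"
    by (auto simp: image_image)
  then show thesis using that l z(2) by metis
qed

section \<open>Algebraic dependence by counting monomials\<close>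

lemma lookup_Const_mult: "lookup (Const c * p) m = c * lookup (p :: 'k::comm_ring_1 mpoly) m"
  by (induction p rule: poly_mapping_additive_induct)
    (auto simp: Const_mult_single lookup_single lookup_add distrib_left when_def)

lemma lookup_le_mdeg: "lookup m i \<le> mdeg m"
  unfolding mdeg_def by (cases "i \<in> keys m") (auto simp: in_keys_iff intro: member_le_sum)

definition exponent_box :: "nat set \<Rightarrow> nat \<Rightarrow> (nat \<Rightarrow>\<^sub>0 nat) set" where
  "exponent_box A T = {m. keys m \<subseteq> A \<and> (\<forall>i. lookup m i \<le> T)}"

lemma exponent_box_finite_card:
  assumes A: "finite A"
  shows "finite (exponent_box A T)" and "card (exponent_box A T) = (T + 1) ^ card A"
proof -
  define \<phi> where "\<phi> g = (\<Sum>i\<in>A. single i (g i))" for g :: "nat \<Rightarrow> nat"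
  have lookup: "lookup (\<phi> g) k = (if k \<in> A then g k else 0)" for g k
    using A by (simp add: \<phi>_def lookup_sum lookup_single when_def)
  have "bij_betw \<phi> (A \<rightarrow>\<^sub>E {..T}) (exponent_box A T)"
  proof (rule bij_betw_byWitness[where f' = "\<lambda>m. restrict (lookup m) A"])
    show "\<forall>g\<in>A \<rightarrow>\<^sub>E {..T}. restrict (lookup (\<phi> g)) A = g"
      by (auto simp: lookup fun_eq_iff PiE_def extensional_def)
    show "\<forall>m\<in>exponent_box A T. \<phi> (restrict (lookup m) A) = m"
      by (auto intro!: poly_mapping_eqI simp: lookup exponent_box_def in_keys_iff)
    show "\<phi> ` (A \<rightarrow>\<^sub>E {..T}) \<subseteq> exponent_box A T"
      by (fastforce simp: exponent_box_def in_keys_iff lookup split: if_splits)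
    show "(\<lambda>m. restrict (lookup m) A) ` exponent_box A T \<subseteq> A \<rightarrow>\<^sub>E {..T}"
      by (auto simp: exponent_box_def)
  qed
  moreover have "finite (A \<rightarrow>\<^sub>E {..T})" "card (A \<rightarrow>\<^sub>E {..T}) = (T + 1) ^ card A"
    using A by (simp_all add: finite_PiE card_PiE flip: Suc_eq_plus1)
  ultimately show "finite (exponent_box A T)" "card (exponent_box A T) = (T + 1) ^ card A"
    by (auto simp: bij_betw_finite dest: bij_betw_same_card)
qed

text \<open>
  The \<open>(T + 1)\<^sup>m\<close> power products of the \<open>y\<^sub>i\<close> with exponents at most \<open>T\<close> are combinations of monomials in the
  variables \<open>W\<close> whose exponents are at most \<open>D m T\<close>, where \<open>D\<close> bounds the degrees of the \<open>y\<^sub>i\<close>.  There are only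
  \<open>(D m T + 1)\<^sup>w\<close> of these with \<open>w = card W < m\<close>, which for large \<open>T\<close> is too few for independence.
\<close>

lemma algebraic_dependence:
  fixes y :: "nat \<Rightarrow> 'k::field mpoly"
  assumes W: "finite W" "card W < m"
    and y: "\<And>i. i \<in> {1..m} \<Longrightarrow> keys (y i) \<subseteq> {\<mu>. keys \<mu> \<subseteq> W}"
  shows "\<exists>f. f \<noteq> 0 \<and> keys f \<subseteq> {\<mu>. keys \<mu> \<subseteq> {1..m}} \<and> subst y f = 0"
proof -
  have "finite (\<Union>i\<in>{1..m}. mdeg ` keys (y i))" by simp
  then obtain D where D: "\<And>i \<mu>. i \<in> {1..m} \<Longrightarrow> \<mu> \<in> keys (y i) \<Longrightarrow> mdeg \<mu> \<le> D"
    unfolding finite_nat_set_iff_bounded_le by blast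
  \<comment> \<open>This \<open>T\<close> absorbs the constant in \<open>(D m T + 1)\<^sup>w \<le> (D m + 1)\<^sup>w (T + 1)\<^sup>w\<close>, leaving \<open>T (T + 1)\<^sup>w < (T + 1)\<^sup>m\<close>.\<close>
  define T where "T = (D * m + 1) ^ card W"
  define A where "A = exponent_box {1..m} T"
  define B where "B = exponent_box W (D * (m * T))"
  have A: "finite A" "card A = (T + 1) ^ m"
    unfolding A_def by (simp_all add: exponent_box_finite_card)
  have B: "finite B" "card B = (D * (m * T) + 1) ^ card W"
    unfolding B_def using W(1) by (simp_all add: exponent_box_finite_card)
  have "D * (m * T) + 1 \<le> (D * m + 1) * (T + 1)"
    by (simp add: algebra_simps)
  then have "card B \<le> ((D * m + 1) * (T + 1)) ^ card W"
    unfolding B by (rule power_mono) simp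
  also have "\<dots> = T * (T + 1) ^ card W"
    by (simp only: power_mult_distrib T_def)
  also have "\<dots> < (T + 1) ^ Suc (card W)"
    by simp
  also have "\<dots> \<le> (T + 1) ^ m"
    using W(2) by (intro power_increasing) auto
  finally have card: "card B < card A" using A by simp
  have keys: "keys (mono_eval y e) \<subseteq> B" if e: "e \<in> A" for e
  proof -
    have "keys e \<subseteq> {1..m}" using e by (auto simp: A_def exponent_box_def)
    then have "mdeg e = (\<Sum>i\<in>{1..m}. lookup e i)"
      by (intro mdeg_superset) simp
    also have "\<dots> \<le> (\<Sum>i\<in>{1..m}. T)"
      using e by (intro sum_mono) (auto simp: A_def exponent_box_def)
    finally have bound: "D * mdeg e \<le> D * (m * T)" by simp
    have kmono: "keys (mono_eval y e) \<subseteq> {\<mu>. keys \<mu> \<subseteq> W \<and> mdeg \<mu> \<le> D * mdeg e}"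
      using y D \<open>keys e \<subseteq> {1..m}\<close>
      by (intro keys_mono_eval_graded[OF graded_monos_le]) blast
    show ?thesis
    proof
      fix \<mu> assume "\<mu> \<in> keys (mono_eval y e)"
      then have "keys \<mu> \<subseteq> W" "mdeg \<mu> \<le> D * (m * T)"
        using kmono bound by (blast intro: order_trans)+
      then show "\<mu> \<in> B"
        using order_trans[OF lookup_le_mdeg] by (simp add: B_def exponent_box_def)
    qed
  qed
  obtain x where x: "\<exists>e\<in>A. x e \<noteq> 0" "\<forall>\<mu>\<in>B. (\<Sum>e\<in>A. x e * lookup (mono_eval y e) \<mu>) = 0"
    using homogeneous_system[OF B(1) A(1) card, of "\<lambda>e. lookup (mono_eval y e)"] by auto
  define f where "f = (\<Sum>e\<in>A. single e (x e))"
  have lookup_f: "lookup f e = (if e \<in> A then x e else 0)" for e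
    using A(1) by (simp add: f_def lookup_sum lookup_single when_def)
  have "f \<noteq> 0" using x(1) lookup_f by (metis lookup_zero)
  moreover have "keys f \<subseteq> {\<mu>. keys \<mu> \<subseteq> {1..m}}"
  proof -
    have "keys f \<subseteq> A" by (auto simp: in_keys_iff lookup_f split: if_splits)
    then show ?thesis unfolding A_def exponent_box_def by blast
  qed
  moreover have "subst y f = 0"
  proof (rule poly_mapping_eqI)
    fix \<mu>
    have "lookup (subst y f) \<mu> = (\<Sum>e\<in>A. x e * lookup (mono_eval y e) \<mu>)"
      by (simp add: f_def subst_sum subst_single lookup_sum lookup_Const_mult)
    also have "\<dots> = 0"
    proof (cases "\<mu> \<in> B")
      case False
      then have "lookup (mono_eval y e) \<mu> = 0" if "e \<in> A" for e
        using keys[OF that] by (auto simp: in_keys_iff)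
      then show ?thesis by simp
    qed (use x(2) in simp)
    finally show "lookup (subst y f) \<mu> = lookup 0 \<mu>" by simp
  qed
  ultimately show ?thesis by blast
qed

lemma monomial_split:
  assumes "i \<in> keys (m :: nat \<Rightarrow>\<^sub>0 nat)"
  shows "m = single i 1 + (m - single i 1)"
  by (rule poly_mapping_eqI) (use assms in \<open>auto simp: lookup_add lookup_minus lookup_single when_def in_keys_iff\<close>)

lemma keys_monomial_diff: "keys (m - single i e) \<subseteq> keys (m :: nat \<Rightarrow>\<^sub>0 nat)"
  by (auto simp: in_keys_iff lookup_minus)

text \<open>
  Division of \<open>f\<close> by a variable, with the remainder free of it.  The conditions on the monomials keep track
  of the variables that occur and of the degree in \<open>x\<^sub>i\<close>.
\<close>

lemma split_off_variable:
  fixes f :: "'k::comm_ring_1 mpoly"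
  obtains f0 f1 where "f = f0 + X i * f1"
    "keys f0 \<subseteq> {m \<in> keys f. lookup m i = 0}" "keys f1 \<subseteq> {m. single i 1 + m \<in> keys f}"
proof -
  let ?A = "{m \<in> keys f. lookup m i = 0}" and ?B = "{m \<in> keys f. i \<in> keys m}"
  define f0 where "f0 = (\<Sum>m\<in>?A. single m (lookup f m))"
  define f1 where "f1 = (\<Sum>m\<in>?B. single (m - single i 1) (lookup f m))"
  have "X i * f1 = (\<Sum>m\<in>?B. single m (lookup f m))"
    unfolding f1_def sum_distrib_left
    by (intro sum.cong refl) (simp add: X_def mult_single flip: monomial_split)
  moreover have "keys f = ?A \<union> ?B" "?A \<inter> ?B = {}"
    by (auto simp: in_keys_iff)
  then have "(\<Sum>m\<in>keys f. single m (lookup f m)) = f0 + (\<Sum>m\<in>?B. single m (lookup f m))"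
    unfolding f0_def by (metis (no_types, lifting) finite_Un finite_keys sum.union_disjoint)
  ultimately have "f = f0 + X i * f1" by (simp add: sum_single_lookup)
  moreover have "keys f0 \<subseteq> ?A"
    unfolding f0_def by (rule keys_sum_subset) auto
  moreover have "keys f1 \<subseteq> {m. single i 1 + m \<in> keys f}"
    unfolding f1_def by (rule keys_sum_subset) (auto simp flip: monomial_split)
  ultimately show thesis by (rule that)
qed

section \<open>Chains of prime ideals and Krull dimension\<close>

lemma greaterThan_Suc_subset: "S \<subseteq> {j<..m} \<Longrightarrow> Suc j \<notin> S \<Longrightarrow> S \<subseteq> {Suc j<..m}"
  by (metis greaterThanAtMost_iff less_antisym not_less_eq subset_iff)

text \<open>
  A relation \<open>f\<close> among \<open>z\<^sub>j\<^sub>+\<^sub>1, \<dots>, z\<^sub>m\<close> modulo \<open>K\<^sub>j\<close> is written as \<open>f\<^sub>0 + x\<^sub>j\<^sub>+\<^sub>1 f\<^sub>1\<close>.  Modulo \<open>K\<^sub>j\<^sub>+\<^sub>1\<close>, which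
  contains \<open>z\<^sub>j\<^sub>+\<^sub>1\<close>, only \<open>f\<^sub>0\<close> survives and is a relation among the later elements, hence 0 by induction
  from the top of the chain.  Since \<open>K\<^sub>j\<close> is prime and \<open>z\<^sub>j\<^sub>+\<^sub>1 \<notin> K\<^sub>j\<close>, the factor \<open>z\<^sub>j\<^sub>+\<^sub>1\<close> can be cancelled, so
  \<open>f\<^sub>1\<close> is again a relation, of smaller degree in \<open>x\<^sub>j\<^sub>+\<^sub>1\<close>.
\<close>

lemma prime_chain_algebraically_independent:
  fixes K :: "nat \<Rightarrow> 'k::field mpoly set"
  assumes K: "\<And>i. i \<le> m \<Longrightarrow> primeideal (K i) (poly_ring n)"
    and mono: "\<And>i. i < m \<Longrightarrow> K i \<subseteq> K (Suc i)"
    and z: "\<And>i. i < m \<Longrightarrow> z (Suc i) \<in> K (Suc i) - K i"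
    and "j \<le> m" "keys f \<subseteq> {\<mu>. keys \<mu> \<subseteq> {j<..m}}" "subst z f \<in> K j"
  shows "f = 0"
  using assms(4-6)
proof (induction "m - j" arbitrary: j f)
  case 0
  then have j: "j = m" by simp
  then have "keys f \<subseteq> {0}" using 0 by auto
  then have f: "f = Const (lookup f 0)"
    by (intro poly_mapping_eqI) (auto simp: Const_def lookup_single when_def in_keys_iff)
  interpret primeideal "K m" "poly_ring n" by (rule K) simp
  have "1 \<notin> K m" using I_notcarr one_imp_carrier by auto
  show ?case
  proof (rule ccontr)
    assume "f \<noteq> 0"
    then have "lookup f 0 \<noteq> 0" using f by (metis Const_simps(1))
    then have "Const (inverse (lookup f 0)) * subst z f = 1"
      by (subst f) (simp flip: Const_mult)
    moreover have "Const (inverse (lookup f 0)) * subst z f \<in> K m"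
      using ideal_mult[OF ideal_axioms Const_polys] 0 j by simp
    ultimately show False using \<open>1 \<notin> K m\<close> by simp
  qed
next
  case (Suc d)
  then have j: "j < m" by simp
  interpret primeideal "K j" "poly_ring n" by (rule K) (use j in simp)
  have IKj: "ideal (K j) (poly_ring n)" by (rule ideal_axioms)
  have IKj': "ideal (K (Suc j)) (poly_ring n)"
    by (rule primeideal.axioms(1)[OF K]) (use j in simp)
  have IH: "f = 0" if "keys f \<subseteq> {\<mu>. keys \<mu> \<subseteq> {Suc j<..m}}" "subst z f \<in> K (Suc j)" for f
    using Suc.hyps(1)[of "Suc j" f] Suc.hyps(2) that j by simp
  have "f = 0" if "keys f \<subseteq> {\<mu>. keys \<mu> \<subseteq> {j<..m} \<and> lookup \<mu> (Suc j) \<le> N}" "subst z f \<in> K j" for f N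
    using that
  proof (induction N arbitrary: f)
    case 0
    have "keys f \<subseteq> {\<mu>. keys \<mu> \<subseteq> {Suc j<..m}}"
    proof
      fix \<mu> assume "\<mu> \<in> keys f"
      then have "keys \<mu> \<subseteq> {j<..m}" "Suc j \<notin> keys \<mu>"
        using 0 by (auto simp: in_keys_iff)
      then have "keys \<mu> \<subseteq> {Suc j<..m}"
        by (rule greaterThan_Suc_subset)
      then show "\<mu> \<in> {\<mu>. keys \<mu> \<subseteq> {Suc j<..m}}" by simp
    qed
    then show ?case using IH mono[OF j] 0 by blast
  next
    case (Suc N)
    obtain f0 f1 where f: "f = f0 + X (Suc j) * f1"
      and f0: "keys f0 \<subseteq> {\<mu> \<in> keys f. lookup \<mu> (Suc j) = 0}"
      and f1: "keys f1 \<subseteq> {\<mu>. single (Suc j) 1 + \<mu> \<in> keys f}"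
      by (rule split_off_variable)
    have sf: "subst z f = subst z f0 + z (Suc j) * subst z f1"
      by (simp add: f subst_add subst_mult)
    have zK: "z (Suc j) \<in> K (Suc j)" "z (Suc j) \<notin> K j" "z (Suc j) \<in> polys n"
      using z[OF j] ideal_subset_polys[OF IKj'] by auto
    have keys_f1: "keys \<mu> \<subseteq> {j<..m} \<and> lookup \<mu> (Suc j) \<le> N" if "\<mu> \<in> keys f1" for \<mu>
    proof -
      have "single (Suc j) 1 + \<mu> \<in> keys f" using f1 that by blast
      then have *: "keys (single (Suc j) 1 + \<mu>) \<subseteq> {j<..m}" "lookup (single (Suc j) 1 + \<mu>) (Suc j) \<le> Suc N"
        using Suc.prems(1) by blast+
      have "keys \<mu> \<subseteq> keys (single (Suc j) 1 + \<mu>)"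
        by (auto simp: in_keys_iff lookup_add)
      with * show ?thesis by (auto simp: lookup_add)
    qed
    have keys_f0: "keys \<mu> \<subseteq> {Suc j<..m}" if "\<mu> \<in> keys f0" for \<mu>
    proof -
      have "\<mu> \<in> keys f" "lookup \<mu> (Suc j) = 0" using f0 that by blast+
      then have "keys \<mu> \<subseteq> {j<..m}" "Suc j \<notin> keys \<mu>"
        using Suc.prems(1) by (blast, simp add: in_keys_iff)
      then show ?thesis by (rule greaterThan_Suc_subset)
    qed
    have "z i \<in> polys n" if "i \<in> {1..m}" for i
    proof -
      obtain i' where i': "i = Suc i'" "i' < m"
        using \<open>i \<in> {1..m}\<close> by (cases i) auto
      then have "z i \<in> K (Suc i')" using z[of i'] by simp
      then show ?thesis
        using ideal_subset_polys[OF primeideal.axioms(1)[OF K[of "Suc i'"]]] i' by auto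
    qed
    moreover have "f1 \<in> polys m"
      using keys_f1 by (fastforce simp: polys_def)
    ultimately have sf1: "subst z f1 \<in> polys n"
      by (rule subst_polys)
    have "z (Suc j) * subst z f1 \<in> K (Suc j)"
      using ideal_mult[OF IKj' sf1 zK(1)] by (simp add: mult.commute)
    moreover have "subst z f \<in> K (Suc j)" using Suc.prems(2) mono[OF j] by blast
    ultimately have "subst z f0 \<in> K (Suc j)"
      using ideal_diff[OF IKj'] sf by fastforce
    then have "f0 = 0" using IH keys_f0 by blast
    then have "z (Suc j) * subst z f1 \<in> K j" using sf Suc.prems(2) by simp
    then have "subst z f1 \<in> K j"
      using I_prime[of "z (Suc j)" "subst z f1"] zK sf1 by simp
    then have "f1 = 0" using Suc.IH[of f1] keys_f1 by blast
    then show "f = 0" using f \<open>f0 = 0\<close> by simp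
  qed
  note no_relation = this
  have "finite (\<Union>\<mu>\<in>keys f. {lookup \<mu> (Suc j)})" by simp
  then obtain N where "\<And>\<mu>. \<mu> \<in> keys f \<Longrightarrow> lookup \<mu> (Suc j) \<le> N"
    unfolding finite_nat_set_iff_bounded_le by blast
  then show ?case using no_relation[of f N] Suc.prems by blast
qed

lemma mono_eval_zero: "f j = 0 \<Longrightarrow> j \<in> keys m \<Longrightarrow> mono_eval f m = 0"
  unfolding mono_eval_def
  by (rule prod_zero, simp, intro bexI[of _ j]) (simp_all add: in_keys_iff zero_power)

text \<open>
  On \<open>k[x\<^sub>1, \<dots>, x\<^sub>n]\<close> with \<open>c \<le> n\<close> the kernel of this substitution is the prime ideal
  \<open>(x\<^sub>1, \<dots>, x\<^sub>c)\<close>.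
\<close>

definition kill_vars :: "nat \<Rightarrow> nat \<Rightarrow> 'k::comm_ring_1 mpoly" where
  "kill_vars c j = (if j \<le> c then 0 else X j)"

lemma mono_eval_kill_vars:
  assumes "\<And>j. j \<in> keys m \<Longrightarrow> c < j"
  shows "mono_eval (kill_vars c) m = single m 1"
proof -
  have "mono_eval (kill_vars c) m = mono_eval X m"
    by (intro mono_eval_cong) (auto simp: kill_vars_def dest: assms)
  then show ?thesis by (simp add: mono_eval_X)
qed

lemma keys_subst_kill_vars:
  "keys (subst (kill_vars c) p) \<subseteq> {m. m \<in> keys p \<and> (\<forall>j\<in>keys m. c < j)}"
proof -
  have "keys (mono_eval (kill_vars c) m :: 'a mpoly) \<subseteq> {m'. m' = m \<and> (\<forall>j\<in>keys m. c < j)}" for m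
  proof (cases "\<forall>j\<in>keys m. c < j")
    case False
    then obtain j where "j \<in> keys m" "j \<le> c" by (auto simp: not_less)
    then have "mono_eval (kill_vars c) m = (0 :: 'a mpoly)"
      by (intro mono_eval_zero) (simp_all add: kill_vars_def)
    then show ?thesis by simp
  qed (simp add: mono_eval_kill_vars)
  then show ?thesis using keys_subst[of "kill_vars c" p] by blast
qed

lemma diff_subst_kill_vars_in_ideal:
  fixes K :: "'k::field mpoly set"
  assumes K: "ideal K (poly_ring n)" and X: "\<And>j. j \<in> {1..c} \<Longrightarrow> X j \<in> K" and p: "p \<in> polys n"
  shows "p - subst (kill_vars c) p \<in> K"
proof -
  have "single m (lookup p m) - subst (kill_vars c) (single m (lookup p m)) \<in> K" if m: "m \<in> keys p" for m
  proof (cases "\<forall>j\<in>keys m. c < j")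
    case True
    then show ?thesis
      using ideal_zero[OF K] by (simp add: subst_single mono_eval_kill_vars Const_mult_single)
  next
    case False
    have mn: "keys m \<subseteq> {1..n}" using p m by (auto simp: polys_def)
    obtain j where j: "j \<in> keys m" "j \<le> c" using False by (auto simp: not_less)
    then have "X j \<in> K" using X mn by auto
    moreover have "single (m - single j 1) (lookup p m) \<in> polys n"
      using mn keys_monomial_diff by (intro single_polys) blast
    ultimately have "single (m - single j 1) (lookup p m) * X j \<in> K"
      by (intro ideal_mult[OF K])
    moreover have "single (m - single j 1) (lookup p m) * X j = single m (lookup p m)"
      using monomial_split[OF j(1)] by (simp add: X_def mult_single add.commute)
    moreover have "mono_eval (kill_vars c) m = (0 :: 'k mpoly)"
      by (rule mono_eval_zero[OF _ j(1)]) (simp add: kill_vars_def j(2))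
    ultimately show ?thesis by (simp add: subst_single)
  qed
  then have "(\<Sum>m\<in>keys p. single m (lookup p m) - subst (kill_vars c) (single m (lookup p m))) \<in> K"
    by (rule ideal_sum[OF K])
  then show ?thesis
    by (simp add: sum_subtractf sum_single_lookup flip: subst_sum)
qed

text \<open>
  Modulo \<open>K\<^sub>0\<close> the first \<open>c\<close> variables can be dropped, so there are witnesses for the strictness of the
  inclusions that are polynomials in the other \<open>n - c\<close> variables.  They are algebraically independent.
\<close>

lemma prime_chain_length:
  fixes K :: "nat \<Rightarrow> 'k::field mpoly set"
  assumes K: "\<And>i. i \<le> m \<Longrightarrow> primeideal (K i) (poly_ring n)"
    and mono: "\<And>i. i < m \<Longrightarrow> K i \<subset> K (Suc i)"
    and X: "\<And>j. j \<in> {1..c} \<Longrightarrow> X j \<in> K 0"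
  shows "m \<le> n - c"
proof (rule ccontr)
  assume "\<not> m \<le> n - c"
  then have m: "card {c<..n} < m" by simp
  have ideal: "ideal (K i) (poly_ring n)" if "i \<le> m" for i
    by (rule primeideal.axioms(1)[OF K[OF that]])
  have K0: "i \<le> m \<Longrightarrow> K 0 \<subseteq> K i" for i
  proof (induction i)
    case (Suc i)
    then show ?case using mono[of i] by auto
  qed simp
  have "\<exists>y. i < m \<longrightarrow> y \<in> K (Suc i) - K i" for i
    using mono[of i] by blast
  then obtain y where y: "\<And>i. i < m \<Longrightarrow> y i \<in> K (Suc i) - K i" by metis
  define z where "z i = subst (kill_vars c) (y (i - 1))" for i
  have z: "z (Suc i) \<in> K (Suc i) - K i" and zW: "keys (z (Suc i)) \<subseteq> {\<mu>. keys \<mu> \<subseteq> {c<..n}}" if i: "i < m" for i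
  proof -
    have yp: "y i \<in> polys n" using y[OF i] ideal_subset_polys[OF ideal[of "Suc i"]] i by auto
    have diff: "y i - z (Suc i) \<in> K i'" if "i' \<le> m" for i'
      using diff_subst_kill_vars_in_ideal[OF ideal[of 0] X yp] K0[OF that] by (auto simp: z_def)
    have "z (Suc i) \<in> K (Suc i)"
      using ideal_diff[OF ideal[of "Suc i"] _ diff[of "Suc i"], of "y i"] y[OF i] i by simp
    moreover have "z (Suc i) \<notin> K i"
      using ideal_add[OF ideal[of i] diff[of i], of "z (Suc i)"] y[OF i] i by auto
    ultimately show "z (Suc i) \<in> K (Suc i) - K i" by blast
    show "keys (z (Suc i)) \<subseteq> {\<mu>. keys \<mu> \<subseteq> {c<..n}}"
      using keys_subst_kill_vars[of c "y i"] yp by (fastforce simp: z_def polys_def)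
  qed
  have "keys (z i) \<subseteq> {\<mu>. keys \<mu> \<subseteq> {c<..n}}" if "i \<in> {1..m}" for i
  proof -
    have "i - 1 < m" "Suc (i - 1) = i" using that by auto
    then show ?thesis using zW by metis
  qed
  then obtain f where f: "f \<noteq> 0" "keys f \<subseteq> {\<mu>. keys \<mu> \<subseteq> {1..m}}" "subst z f = 0"
    using algebraic_dependence[OF _ m, of z] by auto
  have "{1..m} = {0<..m}" by auto
  have mono': "K i \<subseteq> K (Suc i)" if "i < m" for i
    using mono[OF that] by blast
  \<comment> \<open>As \<open>0 \<in> K 0\<close>, the dependence is in particular a relation modulo \<open>K 0\<close>.\<close>
  have "f = 0"
    by (rule prime_chain_algebraically_independent[of m K n z 0 f, OF K mono' z])
      (use f ideal_zero[OF ideal[of 0]] \<open>{1..m} = {0<..m}\<close> in auto)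
  then show False using f(1) by simp
qed

lemma prime_power_in:
  assumes "primeideal K (poly_ring n)" "p \<in> polys n" "p ^ e \<in> K"
  shows "p \<in> K"
proof -
  interpret primeideal K "poly_ring n" by fact
  have "1 \<notin> K" using I_notcarr one_imp_carrier by auto
  have "p ^ e \<in> polys n" for e
    by (induction e) (simp_all add: polys_one polys_mult assms(2))
  then show ?thesis
    using assms(3) \<open>1 \<notin> K\<close> by (induction e) (use I_prime assms(2) in auto)
qed

lemma carrier_quot_ring: "carrier (quot_ring n I) = proj n I ` polys n"
  by (auto simp: FactRing_def A_RCOSETS_def')

text \<open>
  A chain of primes of the quotient lifts to a chain of primes that contain \<open>I\<close>, hence contain every variable
  with a power in \<open>I\<close>.
\<close>

lemma krull_dim_upper:
  fixes I :: "'k::field mpoly set"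
  assumes I: "ideal I (poly_ring n)" and c: "c \<le> n"
    and nil: "\<And>j. j \<in> {1..c} \<Longrightarrow> \<exists>e. X j ^ e \<in> I"
  shows "krull_dim (quot_ring n I) \<le> ereal (real (n - c))"
  unfolding krull_dim_def
proof (rule Sup_least, clarify)
  fix m P
  assume P: "\<forall>i\<le>m. primeideal (P i) (quot_ring n I)" "\<forall>i<m. P i \<subset> P (Suc i)"
  define K where "K i = {r \<in> carrier (poly_ring n). proj n I r \<in> P i}" for i
  have K: "primeideal (K i) (poly_ring n)" if "i \<le> m" for i
    unfolding K_def
    by (rule ring_hom_ring.primeideal_vimage[OF ideal.rcos_ring_hom_ring[OF I] cring_poly_ring])
      (use P(1) that in blast)
  have PK: "P i = proj n I ` K i" if "i \<le> m" for i
    using additive_subgroup.a_subset[OF ideal.axioms(1)[OF primeideal.axioms(1)[OF P(1)[rule_format, OF that]]]]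
    unfolding K_def carrier_quot_ring by auto
  have "K i \<subset> K (Suc i)" if "i < m" for i
  proof -
    have "K i \<subseteq> K (Suc i)" using P(2) that unfolding K_def by blast
    moreover have "K i \<noteq> K (Suc i)" using PK[of i] PK[of "Suc i"] P(2) that by auto
    ultimately show ?thesis by blast
  qed
  moreover have "X j \<in> K 0" if j: "j \<in> {1..c}" for j
  proof -
    obtain e where e: "X j ^ e \<in> I" using nil[OF j] by blast
    have P0: "primeideal (P 0) (quot_ring n I)" using P(1) by blast
    have "X j ^ e \<in> K 0"
      unfolding K_def
      using proj_zero[OF I e] e ideal_subset_polys[OF I]
        additive_subgroup.zero_closed[OF ideal.axioms(1)[OF primeideal.axioms(1)[OF P0]]] by auto
    then show ?thesis
      using prime_power_in[OF K[of 0]] X_polys[of j n] j c by auto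
  qed
  ultimately have "m \<le> n - c"
    by (intro prime_chain_length[of m K n c] K)
  then show "ereal (real m) \<le> ereal (real (n - c))" by simp
qed

lemma kill_vars_prime: "primeideal {p \<in> polys n. subst (kill_vars c) p = (0 :: 'k::field mpoly)} (poly_ring n)"
proof (rule primeidealI)
  let ?K = "{p \<in> polys n. subst (kill_vars c) p = (0 :: 'k mpoly)}"
  show "ideal ?K (poly_ring n)"
    by (rule ideal_poly_ringI) (auto simp: zero_polys polys_add polys_mult subst_add subst_mult)
  show "cring (poly_ring n :: 'k mpoly ring)" by (rule cring_poly_ring)
  have "1 \<notin> ?K" by simp
  then show "carrier (poly_ring n) \<noteq> ?K" using polys_one by fastforce
qed (auto simp: subst_mult)

lemma primeideal_quot:
  fixes I :: "'k::field mpoly set"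
  assumes I: "ideal I (poly_ring n)" and K: "primeideal K (poly_ring n)" and IK: "I \<subseteq> K"
  shows "primeideal (proj n I ` K) (quot_ring n I)"
proof (rule primeidealI)
  interpret primeideal K "poly_ring n" by fact
  note mem = proj_image_iff[OF I ideal_axioms IK]
  show "ideal (proj n I ` K) (quot_ring n I)"
    by (rule poly_ring.ring_ideal_imp_quot_ideal[OF I ideal_axioms])
  show "cring (quot_ring n I)" by (rule ideal.quotient_is_cring[OF I cring_poly_ring])
  have "1 \<notin> K" using I_notcarr one_imp_carrier by auto
  then have "proj n I 1 \<notin> proj n I ` K" using mem[OF polys_one] by simp
  then show "carrier (quot_ring n I) \<noteq> proj n I ` K"
    using proj_carrier[OF I polys_one] by blast
  fix a b assume "a \<in> carrier (quot_ring n I)" "b \<in> carrier (quot_ring n I)"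
    and ab: "a \<otimes>\<^bsub>quot_ring n I\<^esub> b \<in> proj n I ` K"
  then obtain p r where p: "p \<in> polys n" "a = proj n I p" and r: "r \<in> polys n" "b = proj n I r"
    unfolding carrier_quot_ring by blast
  then have "a \<otimes>\<^bsub>quot_ring n I\<^esub> b = proj n I (p * r)"
    using ring_hom_mult[OF ideal.rcos_ring_hom[OF I], of p r] by simp
  then have "p * r \<in> K" using ab mem[OF polys_mult[OF p(1) r(1)]] by simp
  then show "a \<in> proj n I ` K \<or> b \<in> proj n I ` K"
    using I_prime[of p r] p r by auto
qed

text \<open>
  The images of \<open>(x\<^sub>1, \<dots>, x\<^sub>c\<^sub>+\<^sub>i)\<close> for \<open>i = 0, \<dots>, n - c\<close> form a strict chain of prime ideals.
\<close>

lemma krull_dim_lower: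
  fixes I :: "'k::field mpoly set"
  assumes I: "ideal I (poly_ring n)" and c: "\<And>p. p \<in> I \<Longrightarrow> subst (kill_vars c) p = 0"
  shows "ereal (real (n - c)) \<le> krull_dim (quot_ring n I)"
proof -
  define K where "K i = {p \<in> polys n. subst (kill_vars (c + i)) p = (0 :: 'k mpoly)}" for i
  have K: "primeideal (K i) (poly_ring n)" for i
    unfolding K_def by (rule kill_vars_prime)
  have kill_kill: "subst (kill_vars (c + j)) (kill_vars (c + i) k) = kill_vars (c + j) k" if "i \<le> j" for i j k
    using that by (auto simp: kill_vars_def)
  have mono: "K i \<subseteq> K j" if "i \<le> j" for i j
  proof
    fix p assume p: "p \<in> K i"
    have "subst (kill_vars (c + j)) p = subst (kill_vars (c + j)) (subst (kill_vars (c + i)) p)"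
      by (simp add: subst_subst kill_kill[OF that])
    then show "p \<in> K j" using p by (simp add: K_def)
  qed
  have IK: "I \<subseteq> K i" for i
    using mono[of 0 i] c ideal_subset_polys[OF I] by (auto simp: K_def)
  have strict: "proj n I ` K i \<subset> proj n I ` K (Suc i)" if i: "i < n - c" for i
  proof -
    let ?x = "X (c + Suc i) :: 'k mpoly"
    have x: "?x \<in> polys n" using i by (intro X_polys) simp
    have "?x \<noteq> 0" unfolding X_def by (metis lookup_single_eq lookup_zero one_neq_zero)
    then have "?x \<in> K (Suc i)" "?x \<notin> K i" using x by (auto simp: K_def kill_vars_def)
    then have "proj n I ?x \<in> proj n I ` K (Suc i)" "proj n I ?x \<notin> proj n I ` K i"
      using proj_image_iff[OF I primeideal.axioms(1)[OF K[of i]] IK x] by auto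
    then show ?thesis using mono[of i "Suc i"] by auto
  qed
  have "\<exists>P. (\<forall>i\<le>n - c. primeideal (P i) (quot_ring n I)) \<and> (\<forall>i<n - c. P i \<subset> P (Suc i))"
    by (rule exI[of _ "\<lambda>i. proj n I ` K i"]) (use primeideal_quot[OF I K IK] strict in blast)
  then show ?thesis
    unfolding krull_dim_def by (intro Sup_upper) blast
qed

section \<open>Replacing linear forms by variables\<close>

definition contains_monomials :: "'k::field mpoly set \<Rightarrow> nat set \<Rightarrow> nat \<Rightarrow> bool" where
  "contains_monomials I C t \<longleftrightarrow> (\<forall>m. keys m \<subseteq> C \<and> mdeg m = t \<longrightarrow> single m 1 \<in> I)"

text \<open>
  The polynomials whose monomials without variables from \<open>J\<close> lie in \<open>I\<close> form an ideal, and this ideal is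
  \<open>(x\<^sub>J) + I\<close>.
\<close>

lemma covers_variables_iff:
  fixes I :: "'k::field mpoly set"
  assumes I: "monomial_ideal n I" and J: "J \<subseteq> {1..n}"
  shows "covers n I (X ` J) t \<longleftrightarrow> contains_monomials I ({1..n} - J) t"
proof
  have II: "ideal I (poly_ring n)" using I by (rule monomial_ideal_imp_ideal)
  have SI: "X ` J \<union> I \<subseteq> polys n"
    using J X_polys ideal_subset_polys[OF II] by blast
  let ?L = "Idl\<^bsub>poly_ring n\<^esub> (X ` J \<union> I)"
  note L = Idl_ideal[OF SI] and gen = Idl_self[OF SI]
  {
    assume cov: "covers n I (X ` J) t"
    let ?K = "{p :: 'k mpoly. p \<in> polys n \<and> (\<forall>m\<in>keys p. keys m \<inter> J = {} \<longrightarrow> single m 1 \<in> I)}"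
    have "ideal ?K (poly_ring n)"
    proof (rule ideal_poly_ringI)
      fix p q :: "'k mpoly" assume "p \<in> ?K" "q \<in> ?K"
      then show "p + q \<in> ?K"
        using Poly_Mapping.keys_add[of p q] polys_add[of p n q] by blast
    next
      fix r p :: "'k mpoly" assume r: "r \<in> polys n" and p: "p \<in> ?K"
      have "single m 1 \<in> I" if m: "m \<in> keys (r * p)" "keys m \<inter> J = {}" for m
      proof -
        obtain a b where ab: "m = a + b" "a \<in> keys r" "b \<in> keys p"
          using keys_mult[of r p] m by blast
        have "keys b \<subseteq> keys m" by (auto simp: ab(1) in_keys_iff lookup_add)
        then have "single b 1 \<in> I" using p ab(3) m(2) by blast
        then show ?thesis
          using single_add_in_ideal[OF II, of b a] r ab by (simp add: polys_def)
      qed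
      then show "r * p \<in> ?K" using r p polys_mult by blast
    qed (auto simp: zero_polys)
    moreover have "X ` J \<union> I \<subseteq> ?K"
    proof
      fix p assume "p \<in> X ` J \<union> I"
      then consider j where "j \<in> J" "p = X j" | "p \<in> I" by blast
      then show "p \<in> ?K"
      proof cases
        case 1
        then have "p \<in> polys n" using SI by blast
        moreover have "keys p = {single j 1}" using 1 by (simp add: X_def)
        ultimately show ?thesis using 1 by simp
      next
        case 2
        then show ?thesis using monomial_ideal_iff[OF I, of p] by blast
      qed
    qed
    ultimately have LK: "?L \<subseteq> ?K" by (rule Idl_minimal)
    show "contains_monomials I ({1..n} - J) t"
      unfolding contains_monomials_def
    proof clarify
      fix m assume m: "keys m \<subseteq> {1..n} - J" "t = mdeg m"
      then have "single m (1 :: 'k) \<in> forms n t" by (auto simp: forms_iff)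
      then have "single m (1 :: 'k) \<in> ?K" using cov LK unfolding covers_def by blast
      then show "single m 1 \<in> I" using m by auto
    qed
  }
  assume mc: "contains_monomials I ({1..n} - J) t"
  show "covers n I (X ` J) t"
    unfolding covers_def
  proof
    fix p :: "'k mpoly" assume p: "p \<in> forms n t"
    have "single m (lookup p m) \<in> ?L" if m: "m \<in> keys p" for m
    proof (rule single_in_ideal[OF L])
      have mn: "keys m \<subseteq> {1..n}" "mdeg m = t" using p m unfolding forms_iff by blast+
      show "single m 1 \<in> ?L"
      proof (cases "keys m \<inter> J = {}")
        case True
        then have "single m 1 \<in> I" using mc mn unfolding contains_monomials_def by blast
        then show ?thesis using gen by blast
      next
        case False
        then obtain j where j: "j \<in> keys m" "j \<in> J" by blast
        have "single (m - single j 1) 1 \<in> polys n"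
          using mn keys_monomial_diff by (intro single_polys) blast
        then have "single (m - single j 1) 1 * X j \<in> ?L"
          by (rule ideal_mult[OF L]) (use gen j in blast)
        then show ?thesis
          using monomial_split[OF j(1)] by (simp add: X_def mult_single add.commute)
      qed
    qed
    then have "(\<Sum>m\<in>keys p. single m (lookup p m)) \<in> ?L" by (rule ideal_sum[OF L])
    then show "p \<in> ?L" by (simp add: sum_single_lookup)
  qed
qed

text \<open>
  The preimage under \<open>g\<close> of \<open>(S') + I\<close> is an ideal that contains \<open>S\<close> and \<open>I\<close>, and every form is the image
  under \<open>g\<close> of a form of the same degree.
\<close>

lemma covers_transfer:
  fixes I :: "'k::field mpoly set"
  assumes I: "borel_fixed n I" and g: "g \<in> borel n" and h: "h \<in> borel n" and gh: "g * h = 1\<^sub>m n"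
    and S: "S \<subseteq> polys n" "S' \<subseteq> polys n"
    and gS: "\<And>p. p \<in> S \<Longrightarrow> act g p \<in> Idl\<^bsub>poly_ring n\<^esub> (S' \<union> I)"
    and cov: "covers n I S t"
  shows "covers n I S' t"
  unfolding covers_def
proof
  have II: "ideal I (poly_ring n)"
    using I monomial_ideal_imp_ideal unfolding borel_fixed_def by blast
  have SI: "S' \<union> I \<subseteq> polys n" using S ideal_subset_polys[OF II] by blast
  note L = Idl_ideal[OF SI] and gen = Idl_self[OF SI]
  let ?K = "{p \<in> polys n. act g p \<in> Idl\<^bsub>poly_ring n\<^esub> (S' \<union> I)}"
  have "ideal ?K (poly_ring n)"
    by (rule ideal_poly_ringI)
      (auto simp: act_eq_subst subst_add subst_mult zero_polys polys_add polys_mult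
        ideal_zero[OF L] ideal_add[OF L] intro!: ideal_mult[OF L] act_polys[unfolded act_eq_subst])
  moreover have "S \<union> I \<subseteq> ?K"
  proof
    fix p assume p: "p \<in> S \<union> I"
    have "act g p \<in> Idl\<^bsub>poly_ring n\<^esub> (S' \<union> I)" if "p \<in> I"
      using I g that gen unfolding borel_fixed_def by blast
    then show "p \<in> ?K" using p gS S(1) ideal_subset_polys[OF II] by blast
  qed
  ultimately have K: "Idl\<^bsub>poly_ring n\<^esub> (S \<union> I) \<subseteq> ?K" by (rule Idl_minimal)
  fix p :: "'k mpoly" assume p: "p \<in> forms n t"
  then have "act h p \<in> ?K" using act_forms[of p n t h] cov K unfolding covers_def by blast
  moreover have "act g (act h p) = p"
    by (rule act_inverse[OF h g gh]) (use p forms_subset_polys in blast)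
  ultimately show "p \<in> Idl\<^bsub>poly_ring n\<^esub> (S' \<union> I)" by simp
qed

definition linear_form :: "nat \<Rightarrow> (nat \<Rightarrow> 'k::comm_ring_1) \<Rightarrow> 'k mpoly" where
  "linear_form n a = (\<Sum>i=1..n. Const (a i) * X i)"

lemma linear_form_cong: "(\<And>i. i \<in> {1..n} \<Longrightarrow> a i = b i) \<Longrightarrow> linear_form n a = linear_form n b"
  unfolding linear_form_def by (rule sum.cong) auto

lemma linear_form_sum:
  "(\<Sum>r\<in>A. Const (c r) * linear_form n (a r)) = linear_form n (\<lambda>i. \<Sum>r\<in>A. c r * a r i)"
  unfolding linear_form_def sum_distrib_left Const_sum sum_distrib_right
  by (subst sum.swap) (simp add: Const_mult mult.assoc)

lemma mdeg_1_single:
  assumes "mdeg m = 1"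
  obtains i where "m = single i 1"
proof -
  have "keys m \<noteq> {}" using assms by (auto simp: mdeg_def)
  then obtain i where i: "i \<in> keys m" by blast
  have "mdeg m = 1 + mdeg (m - single i 1)"
    by (subst monomial_split[OF i]) (simp add: mdeg_add)
  then have "lookup (m - single i 1) k = 0" for k
    using assms lookup_le_mdeg[of "m - single i 1" k] by simp
  then have "m - single i 1 = 0" by (intro poly_mapping_eqI) simp
  then show thesis using monomial_split[OF i] that by simp
qed

lemma forms_1_linear_form:
  assumes p: "p \<in> forms n 1"
  shows "p = linear_form n (\<lambda>i. lookup p (single i 1))"
proof (rule poly_mapping_eqI)
  fix m
  have "lookup (linear_form n (\<lambda>i. lookup p (single i 1))) m
      = (\<Sum>i=1..n. if single i 1 = m then lookup p (single i 1) else 0)"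
    unfolding linear_form_def lookup_sum lookup_Const_mult
    by (intro sum.cong refl) (simp add: X_def lookup_single when_def)
  also have "\<dots> = lookup p m"
  proof (cases "\<exists>i\<in>{1..n}. m = single i 1")
    case True
    then obtain i where i: "i \<in> {1..n}" "m = single i 1" by blast
    have "single k 1 = m \<longleftrightarrow> k = i" for k :: nat
      unfolding i(2) by (metis lookup_single_eq lookup_single_not_eq one_neq_zero)
    then show ?thesis using i by (simp cong: if_cong)
  next
    case False
    then have "lookup p m = 0"
      using p mdeg_1_single[of m] unfolding forms_iff
      by (metis (mono_tags, lifting) in_keys_iff keys_single insertCI mem_Collect_eq one_neq_zero subset_iff)
    moreover have "(\<Sum>i=1..n. if single i 1 = m then lookup p (single i 1) else 0) = 0"
      by (rule sum.neutral) (use False in auto)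
    ultimately show ?thesis by simp
  qed
  finally show "lookup p m = lookup (linear_form n (\<lambda>i. lookup p (single i 1))) m" by simp
qed

text \<open>
  An echelon basis \<open>b\<close> of the span of the forms provides the columns \<open>j \<in> J\<close> of a unitriangular matrix \<open>g\<close>; the
  other columns are those of the identity.  Then \<open>g\<close> maps \<open>x\<^sub>j\<close> to \<open>b\<^sub>j\<close> for \<open>j \<in> J\<close>, and its inverse maps the
  given forms to combinations of these variables, so \<open>covers_transfer\<close> applies in both directions.
\<close>

lemma linear_forms_to_variables:
  fixes I :: "'k::field mpoly set"
  assumes I: "borel_fixed n I" and l: "\<And>j. j \<in> {1..s} \<Longrightarrow> l j \<in> forms n 1"
  obtains J where "J \<subseteq> {1..n}" "card J \<le> s" "independent_forms n s l \<longrightarrow> card J = s"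
    "\<forall>t. covers n I (l ` {1..s}) t \<longleftrightarrow> covers n I (X ` J) t"
proof -
  have II: "ideal I (poly_ring n)"
    using I monomial_ideal_imp_ideal unfolding borel_fixed_def by blast
  define v where "v = (\<lambda>r i. lookup (l r) (single i 1))"
  have lv: "l r = linear_form n (v r)" if "r \<in> {1..s}" for r
    unfolding v_def by (rule forms_1_linear_form[OF l[OF that]])
  obtain J b where J: "J \<subseteq> {1..n}"
    and b: "\<forall>j\<in>J. b j j = 1 \<and> (\<forall>i\<in>{j<..n}. b j i = 0)"
    and bv: "\<forall>j\<in>J. \<exists>c. \<forall>i\<in>{1..n}. b j i = (\<Sum>r=1..s. c r * v r i)"
    and vb: "\<forall>r\<in>{1..s}. \<exists>e. \<forall>i\<in>{1..n}. v r i = (\<Sum>j\<in>J. e j * b j i)"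
    and le: "card J \<le> s"
    and eq: "(\<forall>c. (\<forall>i\<in>{1..n}. (\<Sum>r=1..s. c r * v r i) = 0) \<longrightarrow> (\<forall>r\<in>{1..s}. c r = 0)) \<longrightarrow> card J = s"
    using echelon_basis[where n = n and s = s and v = v] .
  define g where "g = mat n n (\<lambda>(i, j). if Suc j \<in> J then b (Suc j) (Suc i) else if i = j then 1 else 0)"
  have "g \<in> carrier_mat n n" "\<And>i. i < n \<Longrightarrow> g $$ (i, i) = 1"
    by (auto simp: g_def b)
  moreover have "upper_triangular g"
    by (rule upper_triangularI) (auto simp: g_def b)
  ultimately obtain h where g: "g \<in> borel n" and h: "h \<in> borel n" and hg: "h * g = 1\<^sub>m n" and gh: "g * h = 1\<^sub>m n"
    using unitriangular_borel[of g n] by blast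
  have gX: "act g (X j) = linear_form n (b j)" if j: "j \<in> J" for j
  proof -
    have jn: "j \<in> {1..n}" using J j by blast
    have "act g (X j) = act_var g j" by (simp add: act_eq_subst)
    also have "\<dots> = linear_form n (b j)"
      unfolding act_var_borel[OF g jn] linear_form_def
      by (intro sum.cong refl) (use j jn in \<open>auto simp: g_def\<close>)
    finally show ?thesis .
  qed
  have S: "l ` {1..s} \<subseteq> polys n" "X ` J \<subseteq> polys n"
    using l forms_subset_polys J X_polys by blast+
  have SI: "l ` {1..s} \<union> I \<subseteq> polys n" "X ` J \<union> I \<subseteq> polys n"
    using S ideal_subset_polys[OF II] by blast+
  have gJ: "act g p \<in> Idl\<^bsub>poly_ring n\<^esub> (l ` {1..s} \<union> I)" if p: "p \<in> X ` J" for p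
  proof -
    obtain j where j: "j \<in> J" "p = X j" using p by blast
    obtain c where c: "\<forall>i\<in>{1..n}. b j i = (\<Sum>r=1..s. c r * v r i)" using bv j(1) by blast
    have "act g p = linear_form n (\<lambda>i. \<Sum>r=1..s. c r * v r i)"
      using c unfolding j(2) gX[OF j(1)] by (intro linear_form_cong) blast
    also have "\<dots> = (\<Sum>r=1..s. Const (c r) * l r)"
      unfolding linear_form_sum[symmetric] by (intro sum.cong refl) (simp only: lv)
    also have "\<dots> \<in> Idl\<^bsub>poly_ring n\<^esub> (l ` {1..s} \<union> I)"
      by (intro ideal_sum[OF Idl_ideal[OF SI(1)]] ideal_mult[OF Idl_ideal[OF SI(1)]] Const_polys)
        (use Idl_self[OF SI(1)] in blast)
    finally show ?thesis .
  qed
  have hl: "act h p \<in> Idl\<^bsub>poly_ring n\<^esub> (X ` J \<union> I)" if p: "p \<in> l ` {1..s}" for p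
  proof -
    obtain r where r: "r \<in> {1..s}" "p = l r" using p by blast
    obtain e where e: "\<forall>i\<in>{1..n}. v r i = (\<Sum>j\<in>J. e j * b j i)" using vb r(1) by blast
    have "p = linear_form n (\<lambda>i. \<Sum>j\<in>J. e j * b j i)"
      using e unfolding r(2) lv[OF r(1)] by (intro linear_form_cong) blast
    also have "\<dots> = (\<Sum>j\<in>J. Const (e j) * act g (X j))"
      unfolding linear_form_sum[symmetric] by (intro sum.cong refl) (simp only: gX)
    finally have "act h p = (\<Sum>j\<in>J. Const (e j) * act h (act g (X j)))"
      by (simp add: act_eq_subst[of h] subst_sum subst_mult)
    also have "\<dots> = (\<Sum>j\<in>J. Const (e j) * X j)"
      using act_inverse[OF g h hg] S(2) by (intro sum.cong refl) auto
    also have "\<dots> \<in> Idl\<^bsub>poly_ring n\<^esub> (X ` J \<union> I)"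
      by (intro ideal_sum[OF Idl_ideal[OF SI(2)]] ideal_mult[OF Idl_ideal[OF SI(2)]] Const_polys)
        (use Idl_self[OF SI(2)] in blast)
    finally show ?thesis .
  qed
  have "covers n I (l ` {1..s}) t \<longleftrightarrow> covers n I (X ` J) t" for t
    using covers_transfer[OF I h g hg S hl] covers_transfer[OF I g h gh S(2,1) gJ] by blast
  moreover have "card J = s" if ind: "independent_forms n s l"
  proof (rule eq[THEN mp], intro allI impI ballI)
    fix c r assume c: "\<forall>i\<in>{1..n}. (\<Sum>r=1..s. c r * v r i) = 0" and r: "r \<in> {1..s}"
    have "(\<Sum>r=1..s. Const (c r) * l r) = (\<Sum>r=1..s. Const (c r) * linear_form n (v r))"
      by (intro sum.cong refl) (simp only: lv)
    also have "\<dots> = linear_form n (\<lambda>i. 0)"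
      unfolding linear_form_sum using c by (intro linear_form_cong) blast
    also have "\<dots> = 0" by (simp add: linear_form_def)
    finally show "c r = 0" using ind r unfolding independent_forms_def by blast
  qed
  ultimately show thesis using that J le by blast
qed

section \<open>Moving exponents to smaller variables\<close>

lemma monomial_remove:
  fixes m :: "nat \<Rightarrow>\<^sub>0 nat"
  obtains r where "m = r + single i (lookup m i)" "keys r = keys m - {i}" "mdeg m = mdeg r + lookup m i"
proof -
  let ?r = "m - single i (lookup m i)"
  have m: "m = ?r + single i (lookup m i)"
    by (rule poly_mapping_eqI) (auto simp: lookup_add lookup_minus lookup_single when_def)
  moreover have "keys ?r = keys m - {i}"
    by (auto simp: in_keys_iff lookup_minus lookup_single when_def split: if_splits)
  moreover have "mdeg m = mdeg ?r + lookup m i"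
    by (subst m) (simp add: mdeg_add)
  ultimately show thesis by (rule that)
qed

text \<open>
  As long as \<open>C\<close> misses some \<open>i \<le> u\<close> it has an element \<open>j > u\<close>, and \<open>j\<close> may be replaced by \<open>i\<close>: a
  monomial in the new variables arises from one in the old variables by moving the power of \<open>x\<^sub>j\<close> to \<open>x\<^sub>i\<close>.
\<close>

lemma contains_monomials_initial:
  fixes I :: "'k::field mpoly set"
  assumes I: "borel_fixed n I" and "C \<subseteq> {1..n}" "u \<le> card C" "contains_monomials I C t"
  shows "contains_monomials I {1..u} t"
  using assms(2-4)
proof (induction "card (C \<inter> {u<..})" arbitrary: C rule: less_induct)
  case less
  have fin: "finite C" using less.prems(1) by (rule finite_subset) simp
  show ?case
  proof (cases "{1..u} \<subseteq> C")
    case True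
    then show ?thesis using less.prems(3) unfolding contains_monomials_def by blast
  next
    case False
    then obtain i where "i \<in> {1..u}" "i \<notin> C" by blast
    then have i: "1 \<le> i" "i \<le> u" "i \<notin> C" by auto
    have "\<exists>j\<in>C. u < j"
    proof (rule ccontr)
      assume "\<not> ?thesis"
      then have "C \<subseteq> {1..u} - {i}" using less.prems(1) i by (auto simp: not_less)
      then have "card C \<le> card ({1..u} - {i})" by (intro card_mono) auto
      also have "\<dots> < u" using i by simp
      finally show False using less.prems(2) by simp
    qed
    then obtain j where j: "j \<in> C" "u < j" by blast
    then have jn: "j \<le> n" using less.prems(1) by auto
    let ?C = "insert i (C - {j})"
    have "?C \<inter> {u<..} = C \<inter> {u<..} - {j}" using i by auto
    then have "card (?C \<inter> {u<..}) < card (C \<inter> {u<..})"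
      using fin j by (metis card_Diff1_less IntI finite_Int greaterThan_iff)
    moreover have "?C \<subseteq> {1..n}" using less.prems(1) i j jn by auto
    moreover have "u \<le> card ?C"
      using fin i j less.prems(2) by (simp add: card.insert_remove card_Diff_singleton)
    moreover have "contains_monomials I ?C t"
      unfolding contains_monomials_def
    proof clarify
      fix m assume m: "keys m \<subseteq> ?C" "t = mdeg m"
      obtain r where r: "m = r + single i (lookup m i)" "keys r = keys m - {i}" "mdeg m = mdeg r + lookup m i"
        by (rule monomial_remove)
      have rC: "keys r \<subseteq> C - {j}" using r(2) m(1) by blast
      have "keys (r + single j (lookup m i)) \<subseteq> C"
        by (rule keys_add_vars) (use rC j in auto)
      moreover have "mdeg (r + single j (lookup m i)) = t"
        by (simp add: mdeg_add m(2) r(3))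
      ultimately have "single (r + single j (lookup m i)) 1 \<in> I"
        using less.prems(3) unfolding contains_monomials_def by blast
      then have "single (r + single i (lookup m i)) 1 \<in> I"
        using rC less.prems(1) i j jn by (intro borel_fixed_move[OF I, of i j]) auto
      then show "single m 1 \<in> I" using r(1) by simp
    qed
    ultimately show ?thesis by (rule less.hyps)
  qed
qed

text \<open>
  All powers are moved to \<open>x\<^sub>i\<close> one after the other.  With \<open>i = c + 1 \<le> n\<close> this is what puts \<open>I\<close> inside
  \<open>(x\<^sub>1, \<dots>, x\<^sub>c)\<close>: a monomial of \<open>I\<close> in later variables only would produce a power of \<open>x\<^sub>c\<^sub>+\<^sub>1\<close> in \<open>I\<close>.
\<close>

lemma borel_fixed_merge:
  fixes I :: "'k::field mpoly set"
  assumes I: "borel_fixed n I" and i: "1 \<le> i" "i \<le> n"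
    and "keys m \<subseteq> {i..n}" "single m 1 \<in> I"
  shows "single (single i (mdeg m)) 1 \<in> I"
  using assms(4,5)
proof (induction "card (keys m - {i})" arbitrary: m rule: less_induct)
  case less
  show ?case
  proof (cases "keys m \<subseteq> {i}")
    case True
    have "mdeg m = lookup m i"
      using mdeg_superset[OF _ True] by simp
    moreover have "m = single i (lookup m i)"
      by (rule poly_mapping_eqI) (use True in \<open>auto simp: lookup_single when_def in_keys_iff\<close>)
    ultimately show ?thesis using less.prems(2) by simp
  next
    case False
    then obtain j where j: "j \<in> keys m" "j \<noteq> i" by blast
    obtain r where r: "m = r + single j (lookup m j)" "keys r = keys m - {j}" "mdeg m = mdeg r + lookup m j"
      by (rule monomial_remove)
    let ?m = "r + single i (lookup m j)"
    have "single ?m 1 \<in> I"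
    proof (rule borel_fixed_move[OF I])
      show "i < j" "j \<le> n" using less.prems(1) j by force+
      show "keys r \<subseteq> {1..n}" using less.prems(1) r(2) i by force
    qed (use i r less.prems(2) in auto)
    moreover have "keys ?m \<subseteq> insert i (keys m - {j})"
      by (rule keys_add_vars) (auto simp: r(2))
    then have "keys ?m \<subseteq> {i..n}" "keys ?m - {i} \<subset> keys m - {i}"
      using less.prems(1) i j by auto
    moreover from this(2) have "card (keys ?m - {i}) < card (keys m - {i})"
      by (intro psubset_card_mono) auto
    ultimately have "single (single i (mdeg ?m)) 1 \<in> I" by (intro less.hyps) auto
    then show ?thesis by (simp add: mdeg_add r(3))
  qed
qed

section \<open>Nilpotent variables and the dimension\<close>

definition nilpotent_vars :: "nat \<Rightarrow> 'k::field mpoly set \<Rightarrow> nat set" where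
  "nilpotent_vars n I = {i \<in> {1..n}. \<exists>e. single (single i e) 1 \<in> I}"

lemma nilpotent_vars_initial:
  fixes I :: "'k::field mpoly set"
  assumes I: "borel_fixed n I"
  obtains c where "c \<le> n" "nilpotent_vars n I = {1..c}"
proof -
  let ?Z = "nilpotent_vars n I"
  have down: "i \<in> ?Z" if ij: "1 \<le> i" "i < j" "j \<in> ?Z" for i j
  proof -
    obtain e where "single (single j e) 1 \<in> I" using ij unfolding nilpotent_vars_def by blast
    then have "single (0 + single i e) 1 \<in> I"
      using ij by (intro borel_fixed_move[OF I, of i j]) (auto simp: nilpotent_vars_def)
    then show ?thesis using ij by (auto simp: nilpotent_vars_def)
  qed
  have fin: "finite ?Z" by (simp add: nilpotent_vars_def)
  define c where "c = Max (insert 0 ?Z)"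
  have c: "c \<in> insert 0 ?Z" "\<And>i. i \<in> ?Z \<Longrightarrow> i \<le> c"
    unfolding c_def using fin Max_in[of "insert 0 ?Z"] Max_ge[of "insert 0 ?Z"] by blast+
  have "?Z = {1..c}"
  proof
    have "?Z \<subseteq> {1..}" by (auto simp: nilpotent_vars_def)
    then show "?Z \<subseteq> {1..c}" using c(2) by auto
    show "{1..c} \<subseteq> ?Z"
    proof
      fix i assume "i \<in> {1..c}"
      then show "i \<in> ?Z" using c(1) down[of i c] by (cases "i = c") auto
    qed
  qed
  moreover have "c \<le> n" using c(1) by (auto simp: nilpotent_vars_def)
  ultimately show thesis using that by blast
qed

text \<open>
  Every prime ideal above \<open>I\<close> contains the nilpotent variables \<open>x\<^sub>1, \<dots>, x\<^sub>c\<close>, which bounds the dimension by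
  \<open>n - c\<close>; conversely \<open>borel_fixed_merge\<close> gives \<open>I \<subseteq> (x\<^sub>1, \<dots>, x\<^sub>c)\<close> if \<open>c < n\<close>.
\<close>

lemma nilpotent_vars_dim:
  fixes I :: "'k::field mpoly set"
  assumes I: "borel_fixed n I" and d: "krull_dim (quot_ring n I) = ereal (real d)"
  shows "nilpotent_vars n I = {1..n - d}"
proof -
  have MI: "monomial_ideal n I" using I unfolding borel_fixed_def by blast
  then have II: "ideal I (poly_ring n)" by (rule monomial_ideal_imp_ideal)
  obtain c where c: "c \<le> n" "nilpotent_vars n I = {1..c}" using nilpotent_vars_initial[OF I] .
  have "krull_dim (quot_ring n I) \<le> ereal (real (n - c))"
  proof (rule krull_dim_upper[OF II c(1)])
    fix j assume "j \<in> {1..c}"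
    then show "\<exists>e. X j ^ e \<in> I" using c(2) by (auto simp: nilpotent_vars_def X_power)
  qed
  then have "d \<le> n - c" using d by simp
  moreover have "n - c \<le> d"
  \<comment> \<open>Merging a monomial into \<open>x\<^sub>c\<^sub>+\<^sub>1\<close> requires \<open>c < n\<close>; for \<open>c = n\<close> the bound is trivial.\<close>
  proof (cases "c = n")
    case False
    have "subst (kill_vars c) p = 0" if p: "p \<in> I" for p
    proof -
      have "\<not> (\<forall>j\<in>keys m. c < j)" if m: "m \<in> keys p" for m
      proof
        assume "\<forall>j\<in>keys m. c < j"
        moreover have "single m 1 \<in> I" "keys m \<subseteq> {1..n}"
          using monomial_ideal_iff[OF MI, of p] p m unfolding polys_def by blast+
        ultimately have "keys m \<subseteq> {Suc c..n}"
          by (meson Suc_leI atLeastAtMost_iff subset_iff)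
        then have "single (single (Suc c) (mdeg m)) 1 \<in> I"
          by (rule borel_fixed_merge[OF I, rotated 2]) (use False c(1) \<open>single m 1 \<in> I\<close> in auto)
        then have "Suc c \<in> nilpotent_vars n I" using False c(1) by (auto simp: nilpotent_vars_def)
        then show False using c(2) by simp
      qed
      then have "keys (subst (kill_vars c) p) = {}" using keys_subst_kill_vars[of c p] by blast
      then show ?thesis by simp
    qed
    then have "ereal (real (n - c)) \<le> krull_dim (quot_ring n I)"
      by (rule krull_dim_lower[OF II])
    then show ?thesis using d by simp
  qed simp
  ultimately show ?thesis using c by (metis diff_diff_cancel le_antisym)
qed

text \<open>
  A monomial of large degree in finitely many variables contains a large power of one of them.
\<close>

lemma covers_variables_eventually:
  fixes I :: "'k::field mpoly set"
  assumes I: "monomial_ideal n I" and J: "J \<subseteq> {1..n}"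
  shows "(\<exists>t0. \<forall>t\<ge>t0. covers n I (X ` J) t) \<longleftrightarrow> {1..n} - J \<subseteq> nilpotent_vars n I"
proof
  assume "\<exists>t0. \<forall>t\<ge>t0. covers n I (X ` J) t"
  then obtain t where t: "contains_monomials I ({1..n} - J) t"
    using covers_variables_iff[OF I J] by blast
  show "{1..n} - J \<subseteq> nilpotent_vars n I"
  proof
    fix i assume i: "i \<in> {1..n} - J"
    then have "keys (single i t) \<subseteq> {1..n} - J" by (simp split: if_splits)
    then have "single (single i t) 1 \<in> I"
      using t mdeg_single[of i t] unfolding contains_monomials_def by blast
    then show "i \<in> nilpotent_vars n I" using i unfolding nilpotent_vars_def by blast
  qed
next
  have II: "ideal I (poly_ring n)" using I by (rule monomial_ideal_imp_ideal)
  assume nil: "{1..n} - J \<subseteq> nilpotent_vars n I"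
  then have "\<forall>i\<in>{1..n} - J. \<exists>e. single (single i e) 1 \<in> I" unfolding nilpotent_vars_def by blast
  then obtain e where e: "\<forall>i\<in>{1..n} - J. single (single i (e i)) 1 \<in> I" by metis
  have "contains_monomials I ({1..n} - J) t" if t: "Suc (\<Sum>i\<in>{1..n} - J. e i) \<le> t" for t
    unfolding contains_monomials_def
  proof clarify
    fix m assume m: "keys m \<subseteq> {1..n} - J" "t = mdeg m"
    have "\<exists>i\<in>{1..n} - J. e i \<le> lookup m i"
    proof (rule ccontr)
      assume "\<not> ?thesis"
      then have "(\<Sum>i\<in>{1..n} - J. lookup m i) \<le> (\<Sum>i\<in>{1..n} - J. e i)"
        by (intro sum_mono) (auto simp: not_le intro: less_imp_le)
      then show False using t m(2) mdeg_superset[OF _ m(1)] by simp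
    qed
    then obtain i where i: "i \<in> {1..n} - J" "e i \<le> lookup m i" by blast
    have "m = (m - single i (e i)) + single i (e i)"
      by (rule poly_mapping_eqI) (use i in \<open>auto simp: lookup_add lookup_minus lookup_single when_def\<close>)
    moreover have "single ((m - single i (e i)) + single i (e i)) 1 \<in> I"
      by (rule single_add_in_ideal[OF II]) (use e i m(1) keys_monomial_diff in blast)+
    ultimately show "single m 1 \<in> I" by simp
  qed
  then show "\<exists>t0. \<forall>t\<ge>t0. covers n I (X ` J) t"
    using covers_variables_iff[OF I J] by blast
qed

section \<open>Reduction numbers of Borel-fixed ideals\<close>

lemma var_quot_ideal:
  fixes I :: "'k::field mpoly set"
  assumes I: "monomial_ideal n I" and J: "J \<subseteq> {1..n}" "card J = s"
    and q: "q = quot_ideal n I (var_ideal n J)"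
  shows "s_reduction (quot_ring n I) (quot_gr n I) s q \<longleftrightarrow> {1..n} - J \<subseteq> nilpotent_vars n I"
    and "reduction_number (quot_gr n I) q = (LEAST r. covers n I (X ` J) (r + 1))"
proof -
  have II: "ideal I (poly_ring n)" using I by (rule monomial_ideal_imp_ideal)
  have S: "X ` J \<subseteq> polys n" using J X_polys by blast
  have q': "q = Idl\<^bsub>quot_ring n I\<^esub> (proj n I ` X ` J)"
    unfolding q var_ideal_def by (rule quot_ideal_Idl[OF II S])
  then show "reduction_number (quot_gr n I) q = (LEAST r. covers n I (X ` J) (r + 1))"
    using reduction_number_covers[OF II S] by simp
  have "finite J" using J(1) by (rule finite_subset) simp
  then obtain f where "bij_betw f {1..s} J"
    using J(2) by (metis card_atLeastAtMost diff_Suc_1 finite_atLeastAtMost finite_same_card_bij)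
  then have f: "f ` {1..s} = J" by (rule bij_betw_imp_surj_on)
  then have Xf: "X ` J = (\<lambda>j. X (f j)) ` {1..s}" by (metis image_image)
  have "(\<lambda>j. X (f j)) j \<in> forms n 1" if "j \<in> {1..s}" for j
    using that f J(1) by (intro X_forms) blast
  then have "s_reduction (quot_ring n I) (quot_gr n I) s q \<longleftrightarrow> (\<exists>t0. \<forall>t\<ge>t0. covers n I (X ` J) t)"
    using s_reduction_covers[OF II, of s "\<lambda>j. X (f j)"] unfolding q' Xf by blast
  then show "s_reduction (quot_ring n I) (quot_gr n I) s q \<longleftrightarrow> {1..n} - J \<subseteq> nilpotent_vars n I"
    using covers_variables_eventually[OF I J(1)] by simp
qed

lemma strict_mono_enumeration:
  fixes J :: "nat set"
  assumes "finite J" "card J = k"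
  obtains i where "strict_mono_on {1..k} i" "i ` {1..k} = J"
proof -
  obtain h where h: "bij_betw h {..<k} J" "strict_mono_on {..<k} h"
    using ex_bij_betw_strict_mono_card[OF assms(1)] assms(2) by metis
  have "(\<lambda>x. x - 1) ` {1..k} = {..<k}"
    by (auto simp: image_iff intro!: bexI[of _ "Suc _"])
  then have "(\<lambda>x. h (x - 1)) ` {1..k} = J"
    using bij_betw_imp_surj_on[OF h(1)] by (metis image_image)
  moreover have "strict_mono_on {1..k} (\<lambda>x. h (x - 1))"
    by (intro strict_mono_onI strict_mono_onD[OF h(2)]) auto
  ultimately show thesis using that by blast
qed

theorem theorem1p2:
  fixes I :: "'k::field mpoly set" and n d s :: nat
  assumes "infinite (UNIV :: 'k set)"
    and "borel_fixed n I"
    and "krull_dim (poly_ring n Quot I) = ereal (real d)"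
    and "d \<le> s" and "s \<le> n"
  shows
    "(\<forall>q. indep_s_reduction n I s q \<longrightarrow>
        (\<exists>i :: nat \<Rightarrow> nat. strict_mono_on {1..s - d} i \<and> i ` {1..s - d} \<subseteq> {1..n - d} \<and>
           (let q' = quot_ideal n I (var_ideal n (i ` {1..s - d} \<union> {n - d + 1..n})) in
            s_reduction (poly_ring n Quot I) (quot_gr n I) s q' \<and>
            reduction_number (quot_gr n I) q = reduction_number (quot_gr n I) q')))
     \<and>
     (let q' = quot_ideal n I (var_ideal n {n - s + 1..n}) in
        s_reduction (poly_ring n Quot I) (quot_gr n I) s q' \<and>
        s_reduction_number (poly_ring n Quot I) (quot_gr n I) s = reduction_number (quot_gr n I) q')"
proof (intro conjI allI impI)
  have MI: "monomial_ideal n I" using assms(2) unfolding borel_fixed_def by blast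
  then have II: "ideal I (poly_ring n)" by (rule monomial_ideal_imp_ideal)
  have nil: "nilpotent_vars n I = {1..n - d}" by (rule nilpotent_vars_dim[OF assms(2,3)])
  {
    fix q assume q: "indep_s_reduction n I s q"
    then obtain l where l: "independent_forms n s l" "q = quot_ideal n I (Idl\<^bsub>poly_ring n\<^esub> (l ` {1..s}))"
      and red: "s_reduction (quot_ring n I) (quot_gr n I) s q"
      unfolding indep_s_reduction_def by blast
    have lf: "l j \<in> forms n 1" if "j \<in> {1..s}" for j
      using l(1) that unfolding independent_forms_def by blast
    then have S: "l ` {1..s} \<subseteq> polys n" using forms_subset_polys by blast
    have q': "q = Idl\<^bsub>quot_ring n I\<^esub> (proj n I ` l ` {1..s})"
      unfolding l(2) by (rule quot_ideal_Idl[OF II S])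
    obtain J where "J \<subseteq> {1..n}" "card J \<le> s" "independent_forms n s l \<longrightarrow> card J = s"
      and cov': "\<forall>t. covers n I (l ` {1..s}) t \<longleftrightarrow> covers n I (X ` J) t"
      using linear_forms_to_variables[OF assms(2) lf] .
    then have J: "J \<subseteq> {1..n}" "card J = s" using l(1) by simp_all
    note cov = cov'[rule_format]
    have "\<exists>t0. \<forall>t\<ge>t0. covers n I (X ` J) t"
      using red s_reduction_covers[OF II lf] by (simp add: q' cov)
    then have JZ: "{1..n} - J \<subseteq> {1..n - d}"
      using covers_variables_eventually[OF MI J(1)] nil by simp
    define J0 where "J0 = J - {n - d + 1..n}"
    have top: "{n - d + 1..n} \<subseteq> J"
    proof
      fix x assume "x \<in> {n - d + 1..n}"
      then have "x \<in> {1..n}" "x \<notin> {1..n - d}" by auto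
      then show "x \<in> J" using JZ by blast
    qed
    have fin: "finite J" using J(1) by (rule finite_subset) simp
    have "card J0 = card J - card {n - d + 1..n}"
      unfolding J0_def by (rule card_Diff_subset[OF _ top]) simp
    then have "card J0 = s - d" using assms(4,5) J(2) by simp
    moreover have "finite J0" using fin by (simp add: J0_def)
    ultimately obtain i where i: "strict_mono_on {1..s - d} i" "i ` {1..s - d} = J0"
      using strict_mono_enumeration[of J0 "s - d"] by blast
    have "J0 \<subseteq> {1..n - d}" using J(1) by (fastforce simp: J0_def)
    moreover have "J0 \<union> {n - d + 1..n} = J" using top by (auto simp: J0_def)
    moreover have "reduction_number (quot_gr n I) q = (LEAST r. covers n I (X ` J) (r + 1))"
      unfolding q' reduction_number_covers[OF II S] cov ..
    ultimately show "\<exists>i. strict_mono_on {1..s - d} i \<and> i ` {1..s - d} \<subseteq> {1..n - d} \<and>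
           (let q' = quot_ideal n I (var_ideal n (i ` {1..s - d} \<union> {n - d + 1..n})) in
            s_reduction (quot_ring n I) (quot_gr n I) s q' \<and>
            reduction_number (quot_gr n I) q = reduction_number (quot_gr n I) q')"
      using i var_quot_ideal[OF MI J refl] JZ nil by (intro exI[of _ i]) (simp add: Let_def)
  }
  define J where "J = {n - s + 1..n}"
  define q' where "q' = quot_ideal n I (var_ideal n J)"
  have J: "J \<subseteq> {1..n}" "card J = s" using assms(5) by (auto simp: J_def)
  have compl: "{1..n} - J = {1..n - s}" by (auto simp: J_def)
  have red': "s_reduction (quot_ring n I) (quot_gr n I) s q'"
    unfolding var_quot_ideal(1)[OF MI J q'_def] compl nil using assms(4) by auto
  have "s_reduction_number (quot_ring n I) (quot_gr n I) s = reduction_number (quot_gr n I) q'"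
    unfolding s_reduction_number_def
  proof (rule Least_equality)
    show "\<exists>q. s_reduction (quot_ring n I) (quot_gr n I) s q \<and>
        reduction_number (quot_gr n I) q' = reduction_number (quot_gr n I) q"
      using red' by blast
    fix r assume "\<exists>q. s_reduction (quot_ring n I) (quot_gr n I) s q \<and> r = reduction_number (quot_gr n I) q"
    then obtain q where q: "s_reduction (quot_ring n I) (quot_gr n I) s q" "r = reduction_number (quot_gr n I) q"
      by blast
    obtain l where lf: "\<And>j. j \<in> {1..s} \<Longrightarrow> l j \<in> forms n 1" and ql: "q = Idl\<^bsub>quot_ring n I\<^esub> (proj n I ` l ` {1..s})"
      using s_reduction_lift[OF II q(1)] by blast
    have S: "l ` {1..s} \<subseteq> polys n" using lf forms_subset_polys by blast
    have "\<exists>t0. \<forall>t\<ge>t0. covers n I (l ` {1..s}) t"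
      using q(1) s_reduction_covers[OF II lf] by (simp add: ql)
    then obtain t0 where "\<forall>t\<ge>t0. covers n I (l ` {1..s}) t" by blast
    then have "covers n I (l ` {1..s}) (t0 + 1)" by simp
    then have "covers n I (l ` {1..s}) (r + 1)"
      unfolding q(2) ql reduction_number_covers[OF II S] by (rule LeastI)
    \<comment> \<open>The generators of \<open>q\<close> may be dependent, so only \<open>card K \<le> s\<close> is available here.\<close>
    moreover obtain K where K: "K \<subseteq> {1..n}" "card K \<le> s" "independent_forms n s l \<longrightarrow> card K = s"
      and cov: "\<forall>t. covers n I (l ` {1..s}) t \<longleftrightarrow> covers n I (X ` K) t"
      using linear_forms_to_variables[OF assms(2) lf] .
    ultimately have "contains_monomials I ({1..n} - K) (r + 1)"
      using covers_variables_iff[OF MI K(1)] by blast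
    moreover have "n - s \<le> card ({1..n} - K)"
      using K by (simp add: card_Diff_subset finite_subset)
    ultimately have "contains_monomials I ({1..n} - J) (r + 1)"
      unfolding compl by (intro contains_monomials_initial[OF assms(2), of "{1..n} - K"]) auto
    then have "covers n I (X ` J) (r + 1)" using covers_variables_iff[OF MI J(1)] by blast
    then show "reduction_number (quot_gr n I) q' \<le> r"
      unfolding var_quot_ideal(2)[OF MI J q'_def] by (rule Least_le)
  qed
  then show "let q' = quot_ideal n I (var_ideal n {n - s + 1..n}) in
        s_reduction (quot_ring n I) (quot_gr n I) s q' \<and>
        s_reduction_number (quot_ring n I) (quot_gr n I) s = reduction_number (quot_gr n I) q'"
    using red' unfolding q'_def J_def Let_def by blast
qed

end
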